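(* Let $p_{\xi}(n)$ be defined by $\sum_{n\ge 0} p_{\xi}(n)q^n=\xi(q)$. Then $$\sum_{n=0}^{\infty} p_{\xi}(3n)q^n = \frac{f_{2}f_{3}^4}{f_{1}^2f_{6}^2},\qquad \sum_{n=0}^{\infty} p_{\xi}(3n+1)q^n = 2\frac{f_{3}f_{6}}{f_{1}},\qquad \sum_{n=0}^{\infty} p_{\xi}(3n+2)q^n = \omega(q) + \frac{f_{6}^4}{f_2f_{3}^2}.$$
   Context: For $|q|<1$, $(a;q)_0=1$, $(a;q)_n=(1-a)(1-aq)\cdots(1-aq^{n-1})$, $(a;q)_\infty=\lim_{n\to\infty}(a;q)_n$, and $f_k:=(q^k;q^k)_\infty$. $\xi(q)=1+2\sum_{n\ge1}\frac{q^{6n^2-6n+1}}{(q;q^6)_n(q^5;q^6)_n}$ (a mock theta function of Gordon and McIntosh) and $p_\xi(n)$ is its $n$-th coefficient. $\omega(q)=\sum_{n\ge0}\frac{q^{2n(n+1)}}{(q;q^2)_{n+1}^2}$ is Ramanujan's third order mock theta function. *)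

theory Defs
  imports "HOL-Complex_Analysis.Complex_Analysis"
begin

definition qpoch :: "complex \<Rightarrow> complex \<Rightarrow> nat \<Rightarrow> complex" where
  "qpoch a q n = (\<Prod>k<n. 1 - a * q ^ k)"

definition qpoch_inf :: "complex \<Rightarrow> complex \<Rightarrow> complex" where
  "qpoch_inf a q = lim (\<lambda>n. qpoch a q n)"

definition euler_f :: "nat \<Rightarrow> complex \<Rightarrow> complex" where
  "euler_f k q = qpoch_inf (q ^ k) (q ^ k)"

text \<open>The summand below is meant for \<open>n \<ge> 1\<close>, where the exponent
  \<open>6 n\<^sup>2 - 6 n + 1\<close> involves no truncated subtraction.\<close>

definition xi_summand :: "complex \<Rightarrow> nat \<Rightarrow> complex" where
  "xi_summand q n = q ^ (6 * n ^ 2 - 6 * n + 1) / (qpoch q (q ^ 6) n * qpoch (q ^ 5) (q ^ 6) n)"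

definition mock_xi :: "complex \<Rightarrow> complex" where
  "mock_xi q = 1 + 2 * (\<Sum>n. xi_summand q (Suc n))"

definition mock_omega :: "complex \<Rightarrow> complex" where
  "mock_omega q = (\<Sum>n. q ^ (2 * n * (n + 1)) / (qpoch q (q ^ 2) (n + 1)) ^ 2)"

text \<open>The coefficients are those of the Taylor series at \<open>0\<close>; lemma \<open>p_xi_sums\<close> shows that
  this series converges to \<open>mock_xi\<close> on the whole unit disc, and \<open>p_xi_unique\<close> that
  this determines the coefficients.\<close>

definition p_xi :: "nat \<Rightarrow> complex" where
  "p_xi n = fps_nth (fps_expansion mock_xi 0) n"

lemma qpoch_LIMSEQ:
  assumes "norm q < 1"
  shows "(\<lambda>n. qpoch a q n) \<longlonglongrightarrow> qpoch_inf a q"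
proof -
  have "summable (\<lambda>i. norm ((1 - a * q ^ i) - 1))"
    using assms by (auto simp: norm_mult norm_power intro!: summable_mult summable_geometric)
  then have "convergent (\<lambda>n. \<Prod>i\<le>n. 1 - a * q ^ i)"
    by (intro convergent_prod_imp_convergent abs_convergent_prod_imp_convergent_prod
        summable_imp_abs_convergent_prod)
  then have "convergent (\<lambda>n. qpoch a q (Suc n))"
    unfolding qpoch_def by (simp only: lessThan_Suc_atMost)
  then have "convergent (\<lambda>n. qpoch a q n)"
    by (simp only: convergent_Suc_iff)
  then show ?thesis
    unfolding qpoch_inf_def by (simp add: convergent_LIMSEQ_iff)
qed

lemma norm_one_minus_ge:
  fixes q :: complex
  assumes "norm q \<le> r" "r < 1" "0 < k"
  shows "1 - r \<le> norm (1 - q ^ k)"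
proof -
  have "norm q ^ k \<le> norm q ^ 1"
    using assms by (intro power_decreasing) auto
  then have "norm (q ^ k) \<le> r"
    using assms by (simp add: norm_power)
  then show ?thesis
    using norm_triangle_ineq2[of 1 "q ^ k"] by simp
qed

lemma norm_qpoch_ge:
  assumes "norm q \<le> r" "r < 1" "0 < j"
  shows "(1 - r) ^ n \<le> norm (qpoch (q ^ j) (q ^ m) n)"
proof -
  have "(\<Prod>k<n. 1 - r) \<le> (\<Prod>k<n. norm (1 - q ^ (j + m * k)))"
    using assms by (intro prod_mono conjI norm_one_minus_ge) auto
  then show ?thesis
    by (simp add: qpoch_def prod_norm power_add power_mult)
qed

lemma summable_quadratic_power:
  fixes r C :: real
  assumes "0 \<le> r" "r < 1" "0 < C" "\<And>n. n ^ 2 \<le> e n"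
  shows "summable (\<lambda>n. r ^ e n * C ^ n)"
proof (rule summable_comparison_test_ev)
  have "(\<lambda>n. r ^ n * C) \<longlonglongrightarrow> 0 * C"
    using assms by (intro tendsto_intros LIMSEQ_realpow_zero) auto
  then have "eventually (\<lambda>n. r ^ n * C < 1 / 2) sequentially"
    by (rule order_tendstoD) simp
  then show "eventually (\<lambda>n. norm (r ^ e n * C ^ n) \<le> (1 / 2) ^ n) sequentially"
  proof eventually_elim
    case (elim n)
    have "r ^ e n * C ^ n \<le> r ^ (n ^ 2) * C ^ n"
      using assms by (intro mult_right_mono power_decreasing) auto
    also have "\<dots> = (r ^ n * C) ^ n"
      by (simp add: power_mult_distrib power2_eq_square power_mult)
    also have "\<dots> \<le> (1 / 2) ^ n"
      using assms elim by (intro power_mono) auto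
    finally show ?case
      using assms by simp
  qed
qed (simp add: summable_geometric)

definition xi_bound :: "real \<Rightarrow> nat \<Rightarrow> real" where
  "xi_bound r n = r ^ (6 * (Suc n) ^ 2 - 6 * Suc n + 1) * (1 / (1 - r) ^ 2) ^ Suc n"

lemma summable_xi_bound:
  assumes "0 \<le> r" "r < 1"
  shows "summable (xi_bound r)"
proof -
  have *: "n ^ 2 \<le> 6 * (Suc n) ^ 2 - 6 * Suc n + 1" for n :: nat
    by (simp add: power2_eq_square)
  have "summable (\<lambda>n. (1 / (1 - r) ^ 2) *
          (r ^ (6 * (Suc n) ^ 2 - 6 * Suc n + 1) * (1 / (1 - r) ^ 2) ^ n))"
    by (intro summable_mult summable_quadratic_power *) (use assms in simp_all)
  moreover have "xi_bound r = (\<lambda>n. (1 / (1 - r) ^ 2) *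
          (r ^ (6 * (Suc n) ^ 2 - 6 * Suc n + 1) * (1 / (1 - r) ^ 2) ^ n))"
    unfolding xi_bound_def power_Suc[of "1 / (1 - r) ^ 2"] by (simp only: mult_ac)
  ultimately show ?thesis
    by (simp only:)
qed

lemma norm_xi_summand_le:
  assumes "norm q \<le> r" "r < 1"
  shows "norm (xi_summand q (Suc n)) \<le> xi_bound r n"
proof -
  have r: "0 \<le> r" using assms norm_ge_zero[of q] by linarith
  define m where "m = Suc n"
  define e where "e = 6 * m ^ 2 - 6 * m + 1"
  have "(1 - r) ^ m * (1 - r) ^ m
          \<le> norm (qpoch (q ^ 1) (q ^ 6) m) * norm (qpoch (q ^ 5) (q ^ 6) m)"
    using assms by (intro mult_mono norm_qpoch_ge) auto
  moreover have "0 < (1 - r) ^ m * (1 - r) ^ m"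
    using assms by simp
  moreover have "norm q ^ e \<le> r ^ e"
    using assms by (intro power_mono) auto
  ultimately have "norm q ^ e / (norm (qpoch q (q ^ 6) m) * norm (qpoch (q ^ 5) (q ^ 6) m))
      \<le> r ^ e / ((1 - r) ^ m * (1 - r) ^ m)"
    using r by (intro frac_le) auto
  also have "\<dots> = r ^ e * (1 / (1 - r) ^ 2) ^ m"
    by (simp add: power_divide power2_eq_square power_mult_distrib)
  finally show ?thesis
    unfolding xi_summand_def xi_bound_def m_def[symmetric] e_def[symmetric]
    by (simp add: norm_divide norm_mult norm_power)
qed

lemma summable_xi_summand:
  assumes "norm q < 1"
  shows "summable (\<lambda>n. xi_summand q (Suc n))"
  by (rule summable_comparison_test'[OF summable_xi_bound[of "norm q"], where N = 0])
    (use assms norm_xi_summand_le[of q "norm q"] in simp_all)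

lemma summable_mock_omega:
  assumes "norm q < 1"
  shows "summable (\<lambda>n. q ^ (2 * n * (n + 1)) / (qpoch q (q ^ 2) (n + 1)) ^ 2)"
proof -
  let ?r = "norm q"
  let ?C = "1 / (1 - ?r) ^ 2"
  have "summable (\<lambda>n. ?C * (?r ^ (2 * n * (n + 1)) * ?C ^ n))"
    using assms by (intro summable_mult summable_quadratic_power) (auto simp: power2_eq_square)
  moreover have "norm (q ^ (2 * n * (n + 1)) / (qpoch q (q ^ 2) (n + 1)) ^ 2)
      \<le> ?C * (?r ^ (2 * n * (n + 1)) * ?C ^ n)" for n
  proof -
    have "((1 - ?r) ^ (n + 1)) ^ 2 \<le> norm (qpoch (q ^ 1) (q ^ 2) (n + 1)) ^ 2"
      using assms by (intro power_mono norm_qpoch_ge) auto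
    then have "?r ^ (2 * n * (n + 1)) / norm (qpoch q (q ^ 2) (n + 1)) ^ 2
        \<le> ?r ^ (2 * n * (n + 1)) / ((1 - ?r) ^ (n + 1)) ^ 2"
      using assms by (intro frac_le zero_less_power) auto
    also have "\<dots> = ?C * (?r ^ (2 * n * (n + 1)) * ?C ^ n)"
      by (simp add: power_divide power2_eq_square power_mult_distrib)
    finally show ?thesis
      by (simp add: norm_divide norm_power)
  qed
  ultimately show ?thesis
    by (rule summable_comparison_test'[where N = 0])
qed

lemma holomorphic_xi_summand: "(\<lambda>q. xi_summand q (Suc n)) holomorphic_on ball 0 1"
proof -
  have "qpoch (q ^ j) (q ^ m) (Suc n) \<noteq> 0" if "norm q < 1" "0 < j" for q j m
  proof -
    have "0 < (1 - norm q) ^ Suc n" using that by (intro zero_less_power) auto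
    also have "\<dots> \<le> norm (qpoch (q ^ j) (q ^ m) (Suc n))"
      using that by (intro norm_qpoch_ge) auto
    finally show ?thesis by auto
  qed
  from this[of _ 1 6] this[of _ 5 6] show ?thesis
    unfolding xi_summand_def
    by (intro holomorphic_intros) (auto simp: qpoch_def intro!: holomorphic_intros)
qed

lemma holomorphic_mock_xi: "mock_xi holomorphic_on ball 0 1"
proof -
  have "(\<lambda>q. \<Sum>n. xi_summand q (Suc n)) holomorphic_on ball 0 1"
  proof (rule holomorphic_uniform_sequence)
    show "(\<lambda>q. \<Sum>n<N. xi_summand q (Suc n)) holomorphic_on ball 0 1" for N
      by (intro holomorphic_intros holomorphic_xi_summand)
  next
    fix x :: complex assume x: "x \<in> ball 0 1"
    define d where "d = (1 - norm x) / 2"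
    have d: "0 < d" "norm x + d < 1" using x by (auto simp: d_def field_simps)
    have le: "norm y \<le> norm x + d" if "y \<in> cball x d" for y
      using that norm_triangle_ineq2[of y x] by (auto simp: dist_norm norm_minus_commute)
    have "uniform_limit (cball x d) (\<lambda>N q. \<Sum>n<N. xi_summand q (Suc n))
            (\<lambda>q. \<Sum>n. xi_summand q (Suc n)) sequentially"
      using d le by (intro Weierstrass_m_test[where M = "xi_bound (norm x + d)"]
          norm_xi_summand_le summable_xi_bound) auto
    moreover have "cball x d \<subseteq> ball 0 1"
      using le d by fastforce
    ultimately show "\<exists>d>0. cball x d \<subseteq> ball 0 1 \<and>
        uniform_limit (cball x d) (\<lambda>N q. \<Sum>n<N. xi_summand q (Suc n))
            (\<lambda>q. \<Sum>n. xi_summand q (Suc n)) sequentially"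
      using d by blast
  qed auto
  then show ?thesis
    unfolding mock_xi_def by (intro holomorphic_intros)
qed

lemma p_xi_sums:
  assumes "norm q < 1"
  shows "(\<lambda>n. p_xi n * q ^ n) sums mock_xi q"
  using holomorphic_power_series[OF holomorphic_mock_xi, of q] assms
  by (simp add: p_xi_def fps_expansion_def)

lemma p_xi_unique:
  assumes "\<And>q. norm q < 1 \<Longrightarrow> (\<lambda>n. p n * q ^ n) sums mock_xi q"
  shows "p = p_xi"
proof -
  have *: "mock_xi has_fps_expansion Abs_fps c"
    if "\<And>q. norm q < 1 \<Longrightarrow> (\<lambda>n. c n * q ^ n) sums mock_xi q" for c
  proof (rule has_fps_expansionI)
    show "eventually (\<lambda>q. (\<lambda>n. fps_nth (Abs_fps c) n * q ^ n) sums mock_xi q) (nhds 0)"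
      using that eventually_nhds_in_open[of "ball (0::complex) 1" 0]
      by (auto elim!: eventually_mono)
  qed
  have "Abs_fps p = Abs_fps p_xi"
    by (rule fps_expansion_unique_complex[OF *[OF assms] *[OF p_xi_sums]])
  then show ?thesis
    by (auto simp: fps_eq_iff)
qed

end

theory Submission
  imports Defs
begin

text \<open>Put \<open>\<psi>(q) = f\<^sub>2\<^sup>2 / f\<^sub>1\<close>. The heart of the matter is
  \<open>\<xi>(q) = q\<^sup>2 \<omega>(q\<^sup>3) + \<psi>(q)\<^sup>2 / f\<^sub>6\<close>. The partial fraction expansion of
  \<open>1 / ((z; p)\<^sub>N (p/z; p)\<^sub>N)\<close> says that this sequence and its coefficients form a Bailey pair. Its limit
  for \<open>N \<rightarrow> \<infinity>\<close>, with \<open>p = q\<^sup>2\<close> and \<open>z = q\<close>, is the Lambert series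
  \<open>\<psi>(q)\<^sup>2 = \<Sum> (-1)\<^sup>n q\<^bsup>n(n+1)\<^esup> / (1 - q\<^bsup>2n+1\<^esup>)\<close> over all integers \<open>n\<close>, while Bailey's lemma turns it
  into the Appell-Lerch sums of \<open>\<xi>(q)\<close> (with \<open>p = q\<^sup>6\<close>, \<open>z = q\<close>) and of \<open>\<omega>(q\<^sup>3)\<close>
  (with \<open>p = q\<^sup>6\<close>, \<open>z = q\<^sup>3\<close>). Splitting the Lambert series by \<open>n\<close> modulo 3, the class of 1 is
  \<open>- q\<^sup>2 f\<^sub>6 \<omega>(q\<^sup>3)\<close>, and the other two classes add up to \<open>f\<^sub>6 \<xi>(q)\<close> by the pentagonal number
  theorem. The Jacobi triple product gives the 3-dissection
  \<open>\<psi>(q) = f\<^sub>6 f\<^sub>9\<^sup>2 / (f\<^sub>3 f\<^sub>1\<^sub>8) + q \<psi>(q\<^sup>9)\<close>; squaring it yields the dissection of \<open>\<xi>\<close>.\<close>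

subsection \<open>q-Pochhammer symbols\<close>

lemma qpoch_0 [simp]: "qpoch a p 0 = 1"
  by (simp add: qpoch_def)

lemma qpoch_Suc: "qpoch a p (Suc n) = qpoch a p n * (1 - a * p ^ n)"
  by (simp add: qpoch_def)

lemma qpoch_self_Suc: "qpoch p p (Suc n) = qpoch p p n * (1 - p ^ Suc n)"
  by (simp add: qpoch_def)

lemma one_minus_mult_power_nonzero:
  fixes a p :: complex
  assumes "norm a < 1" "norm p < 1"
  shows "1 - a * p ^ n \<noteq> 0"
proof -
  have "norm (a * p ^ n) \<le> norm a * 1"
    unfolding norm_mult norm_power using assms by (intro mult_left_mono power_le_one) auto
  then have "norm (a * p ^ n) < norm (1::complex)"
    using assms by simp
  then show ?thesis by auto
qed

lemma qpoch_nonzero: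
  assumes "norm a < 1" "norm p < 1"
  shows "qpoch a p n \<noteq> 0"
  using one_minus_mult_power_nonzero[OF assms] by (auto simp: qpoch_def)

text \<open>An absolutely convergent product none of whose factors vanishes has a nonzero limit.
  Every later division by an infinite product rests on this.\<close>

lemma qpoch_inf_nonzero:
  assumes "norm a < 1" "norm p < 1"
  shows "qpoch_inf a p \<noteq> 0"
proof -
  have "summable (\<lambda>i. norm ((1 - a * p ^ i) - 1))"
    using assms by (auto simp: norm_mult norm_power intro!: summable_mult summable_geometric)
  then have "convergent_prod (\<lambda>i. 1 - a * p ^ i)"
    by (intro abs_convergent_prod_imp_convergent_prod summable_imp_abs_convergent_prod)
  then obtain L where L: "(\<lambda>n. \<Prod>i\<le>n. 1 - a * p ^ i) \<longlonglongrightarrow> L" "L \<noteq> 0"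
    using convergent_prod_iff_nz_lim[of "\<lambda>i. 1 - a * p ^ i"]
      one_minus_mult_power_nonzero[OF assms] by blast
  have "(\<lambda>n. qpoch a p (Suc n)) \<longlonglongrightarrow> L"
    using L(1) unfolding qpoch_def by (simp only: lessThan_Suc_atMost)
  moreover have "(\<lambda>n. qpoch a p (Suc n)) \<longlonglongrightarrow> qpoch_inf a p"
    using qpoch_LIMSEQ[OF assms(2)] by (rule LIMSEQ_Suc)
  ultimately show ?thesis
    using L(2) LIMSEQ_unique by blast
qed

text \<open>Sort the factors by the residue \<open>j\<close> of their index modulo \<open>k\<close>.
  For the first \<open>n * k\<close> factors this is a finite rearrangement, and the left-hand side
  is the limit along the multiples of \<open>k\<close>.\<close>

lemma qpoch_inf_multisection:
  assumes "norm p < 1" "0 < k"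
  shows "qpoch_inf a p = (\<Prod>j<k. qpoch_inf (a * p ^ j) (p ^ k))"
proof (rule LIMSEQ_unique)
  have k: "norm (p ^ k) < 1"
    using assms by (simp add: norm_power power_less_one_iff)
  have "(\<lambda>n. qpoch a p (n * k)) \<longlonglongrightarrow> qpoch_inf a p"
    using filterlim_compose[OF qpoch_LIMSEQ[OF assms(1)] mult_nat_right_at_top[OF assms(2)]]
    by (simp add: mult.commute)
  moreover have "qpoch a p (n * k) = (\<Prod>j<k. qpoch (a * p ^ j) (p ^ k) n)" for n
  proof -
    have "qpoch a p (n * k) = (\<Prod>m<n. \<Prod>i\<in>{m * k..<m * k + k}. 1 - a * p ^ i)"
      unfolding qpoch_def by (simp add: prod.nat_group)
    also have "\<dots> = (\<Prod>m<n. \<Prod>j<k. 1 - a * p ^ j * (p ^ k) ^ m)"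
    proof (rule prod.cong[OF refl])
      fix m
      show "(\<Prod>i\<in>{m * k..<m * k + k}. 1 - a * p ^ i) = (\<Prod>j<k. 1 - a * p ^ j * (p ^ k) ^ m)"
        by (rule prod.reindex_bij_witness[where i = "\<lambda>j. m * k + j" and j = "\<lambda>i. i - m * k"])
          (auto simp: mult.assoc mult.commute simp flip: power_mult power_add)
    qed
    also have "\<dots> = (\<Prod>j<k. qpoch (a * p ^ j) (p ^ k) n)"
      unfolding qpoch_def by (rule prod.swap)
    finally show ?thesis .
  qed
  ultimately show "(\<lambda>n. \<Prod>j<k. qpoch (a * p ^ j) (p ^ k) n) \<longlonglongrightarrow> qpoch_inf a p"
    by simp
  show "(\<lambda>n. \<Prod>j<k. qpoch (a * p ^ j) (p ^ k) n)
      \<longlonglongrightarrow> (\<Prod>j<k. qpoch_inf (a * p ^ j) (p ^ k))"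
    by (intro tendsto_prod qpoch_LIMSEQ k)
qed

lemma qpoch_inf_mult_minus:
  assumes "norm p < 1"
  shows "qpoch_inf a p * qpoch_inf (- a) p = qpoch_inf (a ^ 2) (p ^ 2)"
proof (rule LIMSEQ_unique)
  have "norm (p ^ 2) < 1"
    using assms by (simp add: norm_power power_less_one_iff)
  moreover have "qpoch a p n * qpoch (- a) p n = qpoch (a ^ 2) (p ^ 2) n" for n
    unfolding qpoch_def prod.distrib[symmetric]
    by (intro prod.cong) (auto simp: algebra_simps power2_eq_square power_mult_distrib)
  ultimately show "(\<lambda>n. qpoch a p n * qpoch (- a) p n) \<longlonglongrightarrow> qpoch_inf (a ^ 2) (p ^ 2)"
    using qpoch_LIMSEQ[of "p ^ 2" "a ^ 2"] by simp
  show "(\<lambda>n. qpoch a p n * qpoch (- a) p n) \<longlonglongrightarrow> qpoch_inf a p * qpoch_inf (- a) p"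
    by (intro tendsto_mult qpoch_LIMSEQ assms)
qed

lemma qpoch_inf_split_head:
  assumes "norm p < 1"
  shows "qpoch_inf a p = (1 - a) * qpoch_inf (a * p) p"
proof (rule LIMSEQ_unique)
  show "(\<lambda>n. qpoch a p (Suc n)) \<longlonglongrightarrow> qpoch_inf a p"
    using qpoch_LIMSEQ[OF assms] by (rule LIMSEQ_Suc)
  have "qpoch a p (Suc n) = (1 - a) * qpoch (a * p) p n" for n
    unfolding qpoch_def by (subst prod.lessThan_Suc_shift) (simp add: ac_simps)
  then show "(\<lambda>n. qpoch a p (Suc n)) \<longlonglongrightarrow> (1 - a) * qpoch_inf (a * p) p"
    by (auto intro!: tendsto_intros qpoch_LIMSEQ assms)
qed

section \<open>Reciprocals of finite Pochhammer symbols, and limits of sums weighted by them\<close>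

definition inv_qpoch :: "complex \<Rightarrow> nat \<Rightarrow> complex" where
  "inv_qpoch p n = 1 / qpoch p p n"

text \<open>Read from left to right, this brings all reciprocals in an identity to the same highest
  indices. The recurrences below then follow by division-free ring arithmetic.\<close>

lemma inv_qpoch_Suc:
  assumes "norm p < 1"
  shows "inv_qpoch p n = (1 - p ^ Suc n) * inv_qpoch p (Suc n)"
  using one_minus_mult_power_nonzero[OF assms assms, of n]
  by (simp add: inv_qpoch_def qpoch_Suc)

lemma inv_qpoch_LIMSEQ:
  assumes "norm p < 1"
  shows "inv_qpoch p \<longlonglongrightarrow> 1 / qpoch_inf p p"
  unfolding inv_qpoch_def [abs_def]
  by (intro tendsto_divide tendsto_const qpoch_LIMSEQ qpoch_inf_nonzero assms)

lemma inv_qpoch_bounded: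
  assumes "norm p < 1"
  obtains K where "0 < K" "\<And>n. norm (inv_qpoch p n) \<le> K"
  using convergent_imp_Bseq[OF convergentI[OF inv_qpoch_LIMSEQ[OF assms]]]
  by (auto simp: Bseq_def)

text \<open>Tannery's theorem for a triangular array: extended by zero, the finite sums become full
  series. Each fixed \<open>k\<close> is eventually below \<open>N\<close>, so the termwise limits
  are unchanged.\<close>

lemma tannery_triangle:
  fixes a :: "nat \<Rightarrow> nat \<Rightarrow> complex"
  assumes "\<And>k. (\<lambda>N. a k N) \<longlonglongrightarrow> b k"
    and "\<And>k N. k < N \<Longrightarrow> norm (a k N) \<le> M k"
    and "summable M" "\<And>k. 0 \<le> M k"
  shows "(\<lambda>N. \<Sum>k<N. a k N) \<longlonglongrightarrow> suminf b"
proof -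
  define a' where "a' k N = (if k < N then a k N else 0)" for k N
  have "(\<lambda>N. a' k N) \<longlonglongrightarrow> b k" for k
  proof (rule Lim_transform_eventually[OF assms(1)])
    show "eventually (\<lambda>N. a k N = a' k N) sequentially"
      using eventually_gt_at_top[of k] by eventually_elim (simp add: a'_def)
  qed
  then have "(\<lambda>N. suminf (\<lambda>k. a' k N)) \<longlonglongrightarrow> suminf b"
    using assms by (intro tannerys_theorem[where M = M, THEN conjunct2, THEN conjunct2])
      (auto simp: a'_def intro!: always_eventually)
  moreover have "suminf (\<lambda>k. a' k N) = (\<Sum>k<N. a k N)" for N
    by (subst suminf_finite[of "{..<N}"]) (auto simp: a'_def)
  ultimately show ?thesis by simp
qed

text \<open>Both weights are bounded and tend to \<open>1 / qpoch_inf p p\<close>. Shifting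
  \<open>N\<close> to \<open>Suc N\<close> gives the weights \<open>N - n\<close> and
  \<open>Suc N + n\<close> of the Bailey pairs and of the finite triple product.\<close>

lemma inv_qpoch_kernel_LIMSEQ:
  assumes "norm p < 1" "summable (\<lambda>n. norm (\<alpha> n))"
  shows "(\<lambda>N. \<Sum>n<N. \<alpha> n * inv_qpoch p (N - Suc n) * inv_qpoch p (N + n))
           \<longlonglongrightarrow> suminf \<alpha> / qpoch_inf p p ^ 2"
proof -
  obtain K where K: "0 < K" "\<And>n. norm (inv_qpoch p n) \<le> K"
    using inv_qpoch_bounded[OF assms(1)] by blast
  have "(\<lambda>N. \<Sum>n<N. \<alpha> n * inv_qpoch p (N - Suc n) * inv_qpoch p (N + n))
      \<longlonglongrightarrow> (\<Sum>n. \<alpha> n * (1 / qpoch_inf p p) * (1 / qpoch_inf p p))"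
  proof (rule tannery_triangle[where M = "\<lambda>n. norm (\<alpha> n) * K * K"])
    fix n
    show "(\<lambda>N. \<alpha> n * inv_qpoch p (N - Suc n) * inv_qpoch p (N + n))
        \<longlonglongrightarrow> \<alpha> n * (1 / qpoch_inf p p) * (1 / qpoch_inf p p)"
      by (intro tendsto_mult tendsto_const filterlim_compose[OF inv_qpoch_LIMSEQ[OF assms(1)]]
          filterlim_minus_const_nat_at_top filterlim_add_const_nat_at_top)
  qed (use K assms in \<open>auto simp: norm_mult intro!: mult_mono summable_mult2\<close>)
  also have "(\<Sum>n. \<alpha> n * (1 / qpoch_inf p p) * (1 / qpoch_inf p p)) = suminf \<alpha> / qpoch_inf p p ^ 2"
    using suminf_divide[OF summable_norm_cancel[OF assms(2)], of "qpoch_inf p p ^ 2"]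
    by (simp add: power2_eq_square)
  finally show ?thesis .
qed

lemma summable_quadratic_bound:
  fixes p :: complex
  assumes "norm p < 1" "\<And>n. n ^ 2 \<le> e n" 
  shows "summable (\<lambda>n. norm p ^ e n)"
  using summable_quadratic_power[of "norm p" 1 e] assms by simp

section \<open>Durfee rectangle sums\<close>

text \<open>Truncation of the generating function of partitions sorted by their largest
  \<open>M\<close> by \<open>M + k\<close> rectangle. The complete sum therefore counts all
  partitions, whatever \<open>k\<close> is.\<close>

definition durfee_sum :: "complex \<Rightarrow> nat \<Rightarrow> nat \<Rightarrow> complex" where
  "durfee_sum p k N = (\<Sum>M<N. p ^ (M ^ 2 + k * M) * inv_qpoch p M * inv_qpoch p (M + k))"

text \<open>The majorant is free of \<open>k\<close>. This allows the limit in \<open>k\<close>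
  inside \<open>durfee_identity\<close> and the uniform constant in
  \<open>durfee_sum_bounded\<close>.\<close>

lemma norm_durfee_summand_le:
  assumes "norm p < 1" "\<And>n. norm (inv_qpoch p n) \<le> K" "0 < K"
  shows "norm (p ^ (M ^ 2 + k * M) * inv_qpoch p M * inv_qpoch p (M + k))
           \<le> norm p ^ (M ^ 2) * K * K"
proof -
  have "norm p ^ (M ^ 2 + k * M) \<le> norm p ^ (M ^ 2)"
    using assms by (intro power_decreasing) auto
  then show ?thesis
    unfolding norm_mult norm_power using assms by (intro mult_mono) auto
qed

lemma durfee_summable:
  assumes "norm p < 1"
  shows "summable (\<lambda>M. p ^ (M ^ 2 + k * M) * inv_qpoch p M * inv_qpoch p (M + k))"
proof -
  obtain K where K: "0 < K" "\<And>n. norm (inv_qpoch p n) \<le> K"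
    using inv_qpoch_bounded[OF assms(1)] by blast
  have "summable (\<lambda>M. norm p ^ (M ^ 2) * K * K)"
    using assms by (intro summable_mult2 summable_quadratic_bound) auto
  then show ?thesis
    by (rule summable_comparison_test'[where N = 0]) (rule norm_durfee_summand_le[OF assms K(2,1)])
qed

text \<open>If \<open>D k\<close> is the left-hand side, then \<open>D k - D (k + 1) = - p\<^bsup>k+1\<^esup> (D (k + 1) - D (k + 2))\<close>. So the
  differences do not decrease in norm; as \<open>D\<close> converges, they vanish, and \<open>D\<close> equals its limit.\<close>

lemma durfee_identity:
  assumes "norm p < 1"
  shows "(\<Sum>M. p ^ (M ^ 2 + k * M) * inv_qpoch p M * inv_qpoch p (M + k)) = 1 / qpoch_inf p p"
proof -
  define t where "t k M = p ^ (M ^ 2 + k * M) * inv_qpoch p M * inv_qpoch p (M + k)" for k M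
  define D where "D k = suminf (t k)" for k
  have sm: "summable (t k)" for k
    using durfee_summable[OF assms] by (simp add: t_def [abs_def])
  obtain K where K: "0 < K" "\<And>n. norm (inv_qpoch p n) \<le> K"
    using inv_qpoch_bounded[OF assms(1)] by blast
  \<comment> \<open>Only the summand \<open>M = 0\<close> survives, since \<open>p ^ (k * M)\<close>
    tends to 0 for every positive \<open>M\<close>.\<close>
  have lim: "D \<longlonglongrightarrow> 1 / qpoch_inf p p"
  proof -
    have "(\<lambda>k. suminf (t k)) \<longlonglongrightarrow> (\<Sum>M. if M = 0 then 1 / qpoch_inf p p else 0)"
    proof (rule tannerys_theorem[where M = "\<lambda>M. norm p ^ (M ^ 2) * K * K" and a = "\<lambda>M k. t k M",
          THEN conjunct2, THEN conjunct2])
      fix M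
      show "(\<lambda>k. t k M) \<longlonglongrightarrow> (if M = 0 then 1 / qpoch_inf p p else 0)"
      proof (cases "M = 0")
        case True
        then show ?thesis
          using inv_qpoch_LIMSEQ[OF assms] by (simp add: t_def inv_qpoch_def [of p 0])
      next
        case False
        have "norm (p ^ M) < 1"
          using False assms by (simp add: norm_power power_less_one_iff)
        then have "(\<lambda>k. p ^ (M ^ 2) * (p ^ M) ^ k * inv_qpoch p M * inv_qpoch p (k + M))
            \<longlonglongrightarrow> p ^ (M ^ 2) * 0 * inv_qpoch p M * (1 / qpoch_inf p p)"
          by (intro tendsto_mult tendsto_const LIMSEQ_power_zero
              LIMSEQ_ignore_initial_segment inv_qpoch_LIMSEQ assms) auto
        then show ?thesis
          using False by (simp add: t_def power_add power_mult[symmetric] ac_simps)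
      qed
    next
      show "\<forall>\<^sub>F (M, k) in sequentially \<times>\<^sub>F sequentially. norm (t k M) \<le> norm p ^ M\<^sup>2 * K * K"
        unfolding t_def using norm_durfee_summand_le[OF assms K(2,1)] by (simp add: case_prod_unfold)
      show "summable (\<lambda>M. norm p ^ M\<^sup>2 * K * K)"
        using assms by (intro summable_mult2 summable_quadratic_bound) auto
    qed auto
    then show ?thesis
      unfolding D_def [abs_def] by (subst (asm) suminf_finite[of "{0}"]) auto
  qed
  have rec: "D k - D (Suc k) = - (p ^ Suc k) * (D (Suc k) - D (Suc (Suc k)))" for k
  proof -
    \<comment> \<open>Raising the index in \<open>inv_qpoch p (M + k)\<close> splits the difference
      of the terms into \<open>s M\<close> and a multiple of \<open>t (Suc k) M\<close>. The factor
      \<open>1 - p ^ M\<close> makes \<open>s 0\<close> vanish and cancels in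
      \<open>inv_qpoch p M\<close>, so \<open>s\<close> is a shifted multiple of
      \<open>t (Suc (Suc k))\<close>.\<close>
    define s where "s M = p ^ (M ^ 2 + k * M) * (1 - p ^ M) * inv_qpoch p M * inv_qpoch p (M + Suc k)" for M
    have e1: "t k M - t (Suc k) M = s M - p ^ Suc k * t (Suc k) M" for M
      unfolding t_def s_def inv_qpoch_Suc[OF assms, of "M + k"]
      by (simp add: power_add algebra_simps)
    have e2: "s (Suc M) = p ^ Suc k * t (Suc (Suc k)) M" for M
      unfolding t_def s_def inv_qpoch_Suc[OF assms, of M]
      by (simp add: power_add algebra_simps power2_eq_square)
    have s: "summable s"
    proof -
      have "summable (\<lambda>M. (t k M - t (Suc k) M) + p ^ Suc k * t (Suc k) M)"
        by (intro summable_add summable_diff summable_mult sm)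
      then show ?thesis unfolding e1 by simp
    qed
    have "D k - D (Suc k) = (\<Sum>M. t k M - t (Suc k) M)"
      unfolding D_def by (intro suminf_diff sm)
    also have "\<dots> = suminf s - p ^ Suc k * D (Suc k)"
      unfolding e1 D_def using s sm
      by (subst suminf_diff[symmetric]) (auto intro!: summable_mult simp: suminf_mult simp del: power_Suc)
    also have "suminf s = p ^ Suc k * D (Suc (Suc k))"
    proof -
      have "s 0 = 0" by (simp add: s_def)
      then show ?thesis
        using suminf_split_head[OF s] sm unfolding e2 D_def by (simp add: suminf_mult)
    qed
    finally show ?thesis
      by (simp add: algebra_simps)
  qed
  have le: "norm (D k - D (Suc k)) \<le> norm (D (k + m) - D (Suc (k + m)))" for k m
  proof (induction m)
    case (Suc m)
    have "norm p ^ Suc (k + m) \<le> 1"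
      using assms by (intro power_le_one) auto
    then have "norm (D (k + m) - D (Suc (k + m))) \<le> norm (D (Suc (k + m)) - D (Suc (Suc (k + m))))"
      unfolding rec[of "k + m"] norm_mult norm_minus_cancel norm_power
      by (intro mult_left_le_one_le) auto
    then show ?case using Suc by simp
  qed simp
  have "D k = D (Suc k)" for k
  proof -
    have "(\<lambda>m. norm (D (m + k) - D (m + Suc k))) \<longlonglongrightarrow> norm (1 / qpoch_inf p p - 1 / qpoch_inf p p)"
      by (intro tendsto_norm tendsto_diff LIMSEQ_ignore_initial_segment lim)
    then have "(\<lambda>m. norm (D (k + m) - D (Suc (k + m)))) \<longlonglongrightarrow> 0"
      by (simp add: ac_simps)
    then have "norm (D k - D (Suc k)) \<le> 0"
      by (rule Lim_bounded2) (use le in auto)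
    then show ?thesis by simp
  qed
  then have "D k = D m" for m
    by (metis nat_induct[of "\<lambda>m. D m = D 0"])
  then have "D = (\<lambda>_. D k)" by metis
  with lim have "D k = 1 / qpoch_inf p p"
    by (metis LIMSEQ_const_iff)
  then show ?thesis by (simp add: D_def t_def [abs_def])
qed

subsection \<open>Bailey pairs\<close>

lemma durfee_sum_LIMSEQ:
  assumes "norm p < 1"
  shows "durfee_sum p k \<longlonglongrightarrow> 1 / qpoch_inf p p"
  using summable_LIMSEQ[OF durfee_summable[OF assms, of k]]
  unfolding durfee_identity[OF assms] durfee_sum_def [abs_def] .

lemma durfee_sum_bounded:
  assumes "norm p < 1"
  obtains C where "0 \<le> C" "\<And>k N. norm (durfee_sum p k N) \<le> C"
proof -
  obtain K where K: "0 < K" "\<And>n. norm (inv_qpoch p n) \<le> K"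
    using inv_qpoch_bounded[OF assms] by blast
  define C where "C = (\<Sum>M. norm p ^ (M ^ 2) * K * K)"
  have s: "summable (\<lambda>M. norm p ^ (M ^ 2) * K * K)"
    using assms by (intro summable_mult2 summable_quadratic_bound) auto
  have "norm (durfee_sum p k N) \<le> C" for k N
  proof -
    have "norm (durfee_sum p k N) \<le> (\<Sum>M<N. norm p ^ (M ^ 2) * K * K)"
      unfolding durfee_sum_def by (intro sum_norm_le norm_durfee_summand_le assms K)
    also have "\<dots> \<le> C"
      unfolding C_def using s K by (intro sum_le_suminf) auto
    finally show ?thesis .
  qed
  moreover have "0 \<le> C"
    unfolding C_def using s K by (intro suminf_nonneg) auto
  ultimately show ?thesis using that by blast
qed

text \<open>Interchange of summation. For fixed \<open>n\<close> put \<open>N = n + M\<close>; then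
  \<open>N^2 + N = (n^2 + n) + (M^2 + (2 * n + 1) * M)\<close>, so the sum over \<open>N\<close> is
  a Durfee sum with \<open>k = 2 * n + 1\<close>. The induction adds one \<open>N\<close> at a
  time.\<close>

lemma bailey_partial_sum:
  "(\<Sum>N<L. p ^ (N ^ 2 + N) * (\<Sum>n<Suc N. \<alpha> n * inv_qpoch p (N - n) * inv_qpoch p (Suc N + n)))
     = (\<Sum>n<L. \<alpha> n * p ^ (n ^ 2 + n) * durfee_sum p (2 * n + 1) (L - n))"
proof (induction L)
  case (Suc L)
  have *: "\<alpha> n * p ^ (n ^ 2 + n) * durfee_sum p (2 * n + 1) (Suc L - n)
      = \<alpha> n * p ^ (n ^ 2 + n) * durfee_sum p (2 * n + 1) (L - n)
        + p ^ (L ^ 2 + L) * (\<alpha> n * inv_qpoch p (L - n) * inv_qpoch p (Suc L + n))"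
    if "n < Suc L" for n
  proof -
    obtain m where L: "L = n + m" using \<open>n < Suc L\<close> by (auto simp: less_Suc_eq_le le_iff_add)
    have "n ^ 2 + n + (m ^ 2 + (2 * n + 1) * m) = L ^ 2 + L"
      unfolding L by (simp add: power2_eq_square algebra_simps)
    then have "p ^ (n ^ 2 + n) * p ^ (m ^ 2 + (2 * n + 1) * m) = p ^ (L ^ 2 + L)"
      by (simp only: flip: power_add)
    moreover have "durfee_sum p (2 * n + 1) (Suc L - n) = durfee_sum p (2 * n + 1) (L - n)
        + p ^ (m ^ 2 + (2 * n + 1) * m) * inv_qpoch p m * inv_qpoch p (Suc L + n)"
      unfolding L by (simp add: durfee_sum_def Suc_diff_le mult_2 mult_2_right ac_simps)
    ultimately show ?thesis
      unfolding L by (simp add: algebra_simps)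
  qed
  have "(\<Sum>n<Suc L. \<alpha> n * p ^ (n ^ 2 + n) * durfee_sum p (2 * n + 1) (Suc L - n))
      = (\<Sum>n<Suc L. \<alpha> n * p ^ (n ^ 2 + n) * durfee_sum p (2 * n + 1) (L - n))
        + p ^ (L ^ 2 + L) * (\<Sum>n<Suc L. \<alpha> n * inv_qpoch p (L - n) * inv_qpoch p (Suc L + n))"
    unfolding sum_distrib_left sum.distrib[symmetric] by (intro sum.cong * ) auto
  \<comment> \<open>The term \<open>n = L\<close> drops out, because its Durfee sum is
    empty.\<close>
  also have "(\<Sum>n<Suc L. \<alpha> n * p ^ (n ^ 2 + n) * durfee_sum p (2 * n + 1) (L - n))
      = (\<Sum>n<L. \<alpha> n * p ^ (n ^ 2 + n) * durfee_sum p (2 * n + 1) (L - n))"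
    by (simp add: durfee_sum_def)
  finally show ?case using Suc.IH by simp
qed simp

text \<open>The limiting case of Bailey's lemma relative to \<open>a = p\<close>, with both free
  parameters sent to infinity; the usual constant \<open>1 - p\<close> is absorbed in
  \<open>\<alpha>\<close>. It follows from \<open>bailey_partial_sum\<close> by dominated
  convergence, as all Durfee sums have the same limit.\<close>

lemma bailey_sums:
  assumes "norm p < 1" "summable (\<lambda>n. norm (\<alpha> n))"
    and \<beta>: "\<And>N. \<beta> N = (\<Sum>n<Suc N. \<alpha> n * inv_qpoch p (N - n) * inv_qpoch p (Suc N + n))"
  shows "(\<lambda>N. p ^ (N ^ 2 + N) * \<beta> N) sums ((\<Sum>n. \<alpha> n * p ^ (n ^ 2 + n)) / qpoch_inf p p)"
proof -
  obtain C where C: "0 \<le> C" "\<And>k N. norm (durfee_sum p k N) \<le> C"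
    using durfee_sum_bounded[OF assms(1)] by blast
  have le: "norm (\<alpha> n * p ^ (n ^ 2 + n)) \<le> norm (\<alpha> n)" for n
  proof -
    have "norm p ^ (n ^ 2 + n) \<le> 1" using assms by (intro power_le_one) auto
    then show ?thesis by (simp add: norm_mult norm_power mult_left_le)
  qed
  have s: "summable (\<lambda>n. \<alpha> n * p ^ (n ^ 2 + n))"
    by (rule summable_comparison_test'[OF assms(2), where N = 0]) (rule le)
  have "(\<lambda>L. \<Sum>n<L. \<alpha> n * p ^ (n ^ 2 + n) * durfee_sum p (2 * n + 1) (L - n))
      \<longlonglongrightarrow> (\<Sum>n. \<alpha> n * p ^ (n ^ 2 + n) * (1 / qpoch_inf p p))"
  proof (rule tannery_triangle[where M = "\<lambda>n. norm (\<alpha> n) * C"])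
    show "(\<lambda>L. \<alpha> n * p ^ (n ^ 2 + n) * durfee_sum p (2 * n + 1) (L - n))
        \<longlonglongrightarrow> \<alpha> n * p ^ (n ^ 2 + n) * (1 / qpoch_inf p p)" for n
      by (intro tendsto_mult tendsto_const filterlim_compose[OF durfee_sum_LIMSEQ[OF assms(1)]]
          filterlim_minus_const_nat_at_top)
    show "norm (\<alpha> n * p ^ (n ^ 2 + n) * durfee_sum p (2 * n + 1) (L - n)) \<le> norm (\<alpha> n) * C" for n L
      unfolding norm_mult[of "\<alpha> n * p ^ (n ^ 2 + n)"] using le C by (intro mult_mono) auto
  qed (use C assms in \<open>auto intro: summable_mult2\<close>)
  then show ?thesis
    using suminf_divide[OF s, of "qpoch_inf p p"]
    unfolding sums_def \<beta> bailey_partial_sum by simp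
qed

lemma Suc_choose_two: "Suc n choose 2 = n + (n choose 2)"
  by (simp add: numeral_2_eq_2)

lemma add_choose_two: "(m + n) choose 2 = (m choose 2) + (n choose 2) + m * (n :: nat)"
  by (induction n) (simp_all add: Suc_choose_two)

text \<open>Multiplied by \<open>1 - p\<^sup>N\<close>, the sum telescopes.\<close>

lemma unit_bailey_pair:
  assumes "norm p < 1" "0 < N"
  shows "(\<Sum>n<Suc N. (-1) ^ n * p ^ (n choose 2) * (1 - p ^ (2 * n + 1))
            * inv_qpoch p (N - n) * inv_qpoch p (Suc N + n)) = 0" (is "(\<Sum>n<_. ?t n) = 0")
proof -
  define u where "u n = (-1) ^ n * p ^ (n choose 2) * (1 - p ^ n)
    * inv_qpoch p (N - n) * inv_qpoch p (N + n)" for n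
  have step: "(1 - p ^ N) * ?t n = u n - u (Suc n)" if n: "n < N" for n
  proof -
    obtain m where N: "N = n + Suc m" using n less_imp_Suc_add by fastforce
    have e1: "inv_qpoch p m = (1 - p ^ Suc m) * inv_qpoch p (Suc m)"
      by (rule inv_qpoch_Suc[OF assms(1)])
    have e2: "inv_qpoch p (N + n) = (1 - p ^ Suc (N + n)) * inv_qpoch p (Suc (N + n))"
      by (rule inv_qpoch_Suc[OF assms(1)])
    have d: "N - n = Suc m" "N - Suc n = m" "N + Suc n = Suc (N + n)" "Suc N + n = Suc (N + n)"
      using N by auto
    show ?thesis
      unfolding u_def d e1 e2 unfolding N
      by (simp add: Suc_choose_two power_add algebra_simps mult_2 mult_2_right)
  qed
  \<comment> \<open>The last term stands apart from the telescoping: truncated subtraction would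
    give \<open>u (Suc N)\<close> the factor \<open>inv_qpoch p 0 = 1\<close> where the pattern
    calls for 0.\<close>
  have last: "(1 - p ^ N) * ?t N = u N"
    unfolding u_def inv_qpoch_Suc[OF assms(1), of "N + N"]
    by (simp add: algebra_simps mult_2 mult_2_right)
  have "(1 - p ^ N) * (\<Sum>n<Suc N. ?t n) = (\<Sum>n<N. (1 - p ^ N) * ?t n) + (1 - p ^ N) * ?t N"
    by (simp add: sum_distrib_left distrib_left)
  also have "\<dots> = (\<Sum>n<N. u n - u (Suc n)) + u N"
    unfolding last using step by simp
  also have "\<dots> = u 0"
    unfolding sum_lessThan_telescope'[of u] by simp
  also have "u 0 = 0" by (simp add: u_def)
  finally show ?thesis
    using one_minus_mult_power_nonzero[OF assms(1,1), of "N - 1"] assms(2)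
    by (cases N) (auto simp del: sum.lessThan_Suc)
qed

text \<open>For \<open>z y = p\<close> this is the sum of the terms of indices \<open>n\<close> and \<open>- 1 - n\<close> of the bilateral series
  \<open>\<Sum> (-1)\<^sup>n p\<^bsup>n(n+1)/2\<^esup> / (1 - z p\<^sup>n)\<close>. Folding it in this way keeps all exponents and indices natural.\<close>

definition theta_coeff :: "complex \<Rightarrow> complex \<Rightarrow> complex \<Rightarrow> nat \<Rightarrow> complex" where
  "theta_coeff p z y n =
     (-1) ^ n * p ^ (Suc n choose 2) * (1 - p ^ (2 * n + 1)) / ((1 - z * p ^ n) * (1 - y * p ^ n))"

text \<open>A partial fraction expansion in the variable \<open>z + y\<close>, on which the factors
  \<open>(1 - z p\<^sup>n) (1 - y p\<^sup>n)\<close> depend linearly.\<close>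

lemma theta_bailey_pair:
  assumes p: "norm p < 1" and z: "norm z < 1" and y: "norm y < 1" and zy: "z * y = p"
  shows "1 / (qpoch z p (Suc N) * qpoch y p (Suc N))
    = (\<Sum>n<Suc N. theta_coeff p z y n * inv_qpoch p (N - n) * inv_qpoch p (Suc N + n))"
proof (induction N)
  case 0
  have "1 - z \<noteq> 0" "1 - y \<noteq> 0" "1 - p \<noteq> 0"
    using one_minus_mult_power_nonzero[OF z p, of 0] one_minus_mult_power_nonzero[OF y p, of 0]
      one_minus_mult_power_nonzero[OF p p, of 0] by auto
  then show ?case
    by (simp add: theta_coeff_def qpoch_def inv_qpoch_def binomial_eq_0)
next
  case (Suc N)
  let ?M = "Suc N"
  let ?S = "\<Sum>n<Suc ?M. theta_coeff p z y n * inv_qpoch p (?M - n) * inv_qpoch p (Suc ?M + n)"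
  let ?c = "(1 - z * p ^ ?M) * (1 - y * p ^ ?M)"
  have nz: "1 - z * p ^ n \<noteq> 0" "1 - y * p ^ n \<noteq> 0" for n
    using one_minus_mult_power_nonzero[OF z p] one_minus_mult_power_nonzero[OF y p] by auto
  \<comment> \<open>As a function of \<open>z + y\<close>, the new factor \<open>?c\<close> is
    linear. It is written as a multiple of the factor of index \<open>n\<close> plus a remainder
    free of \<open>z\<close> and \<open>y\<close>.\<close>
  have split: "?c = p ^ (?M - n) * ((1 - z * p ^ n) * (1 - y * p ^ n))
      + (1 - p ^ (?M - n)) * (1 - p ^ (Suc ?M + n))" if "n < Suc ?M" for n
  proof -
    obtain m where M: "?M = n + m" using \<open>n < Suc ?M\<close> by (metis le_iff_add less_Suc_eq_le)
    have "(1 - z * p ^ ?M) * (1 - y * p ^ ?M) = 1 - (z + y) * p ^ ?M + z * y * (p ^ ?M) ^ 2"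
      "(1 - z * p ^ n) * (1 - y * p ^ n) = 1 - (z + y) * p ^ n + z * y * (p ^ n) ^ 2"
      by (simp_all add: algebra_simps power2_eq_square)
    moreover have "p ^ ?M = p ^ n * p ^ m" "p ^ (Suc ?M + n) = p * p ^ n * p ^ m * p ^ n" "?M - n = m"
      unfolding M by (simp_all add: power_add)
    ultimately show ?thesis
      unfolding zy by (simp only:) (simp add: algebra_simps power2_eq_square)
  qed
  \<comment> \<open>The multiple cancels the denominator of \<open>theta_coeff\<close> and leaves
    the summand of \<open>unit_bailey_pair\<close>. The remainder lowers both reciprocal indices,
    which leads back to the sum for \<open>N\<close>.\<close>
  have summand: "?c * (theta_coeff p z y n * inv_qpoch p (?M - n) * inv_qpoch p (Suc ?M + n))
      = p ^ ?M * ((-1) ^ n * p ^ (n choose 2) * (1 - p ^ (2 * n + 1))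
          * inv_qpoch p (?M - n) * inv_qpoch p (Suc ?M + n))
        + theta_coeff p z y n * ((1 - p ^ (?M - n)) * inv_qpoch p (?M - n)) * inv_qpoch p (?M + n)"
    if n: "n < Suc ?M" for n
  proof -
    have a: "theta_coeff p z y n * ((1 - z * p ^ n) * (1 - y * p ^ n))
        = (-1) ^ n * p ^ (Suc n choose 2) * (1 - p ^ (2 * n + 1))"
      using nz by (simp add: theta_coeff_def)
    have e: "p ^ (?M - n) * p ^ (Suc n choose 2) = p ^ ?M * p ^ (n choose 2)"
      using n by (simp add: Suc_choose_two flip: power_add)
    have assoc: "u * (s * v * w) = (u * v) * (s * w)" for u v w s :: complex
      by (simp only: mult_ac)
    have b: "p ^ (?M - n) * (theta_coeff p z y n * ((1 - z * p ^ n) * (1 - y * p ^ n)))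
        = p ^ ?M * ((-1) ^ n * p ^ (n choose 2) * (1 - p ^ (2 * n + 1)))"
      unfolding a assoc e ..
    have c: "inv_qpoch p (?M + n) = (1 - p ^ (Suc ?M + n)) * inv_qpoch p (Suc ?M + n)"
      using inv_qpoch_Suc[OF p, of "?M + n"] by simp
    have "?c * (theta_coeff p z y n * inv_qpoch p (?M - n) * inv_qpoch p (Suc ?M + n))
      = (p ^ (?M - n) * (theta_coeff p z y n * ((1 - z * p ^ n) * (1 - y * p ^ n))))
           * inv_qpoch p (?M - n) * inv_qpoch p (Suc ?M + n)
        + theta_coeff p z y n * ((1 - p ^ (?M - n)) * inv_qpoch p (?M - n))
           * ((1 - p ^ (Suc ?M + n)) * inv_qpoch p (Suc ?M + n))"
      unfolding split[OF n] by (simp only: distrib_right distrib_left mult_ac)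
    then show ?thesis
      unfolding b c[symmetric] by (simp only: mult.assoc)
  qed
  \<comment> \<open>The cancelled parts add up to 0 by \<open>unit_bailey_pair\<close>. In the other
    sum the term \<open>n = ?M\<close> vanishes through \<open>1 - p ^ 0\<close>.\<close>
  have "?c * ?S = p ^ ?M * 0
      + (\<Sum>n<Suc ?M. theta_coeff p z y n * ((1 - p ^ (?M - n)) * inv_qpoch p (?M - n)) * inv_qpoch p (?M + n))"
    unfolding sum_distrib_left unit_bailey_pair[OF p, of ?M, OF zero_less_Suc, symmetric]
    unfolding sum.distrib[symmetric] by (intro sum.cong summand) auto
  also have "\<dots> = (\<Sum>n<?M. theta_coeff p z y n * ((1 - p ^ (?M - n)) * inv_qpoch p (?M - n)) * inv_qpoch p (?M + n))"
    by simp
  also have "\<dots> = (\<Sum>n<?M. theta_coeff p z y n * inv_qpoch p (N - n) * inv_qpoch p (?M + n))"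
  proof (rule sum.cong[OF refl])
    fix n assume "n \<in> {..<?M}"
    then have "inv_qpoch p (N - n) = (1 - p ^ (?M - n)) * inv_qpoch p (?M - n)"
      using inv_qpoch_Suc[OF p, of "N - n"] by (simp add: Suc_diff_le)
    then show "theta_coeff p z y n * ((1 - p ^ (?M - n)) * inv_qpoch p (?M - n)) * inv_qpoch p (?M + n)
        = theta_coeff p z y n * inv_qpoch p (N - n) * inv_qpoch p (?M + n)"
      by simp
  qed
  also have "\<dots> = 1 / (qpoch z p (Suc N) * qpoch y p (Suc N))"
    by (rule Suc.IH[symmetric])
  finally have "?c * ?S = 1 / (qpoch z p (Suc N) * qpoch y p (Suc N))" .
  moreover have "?c \<noteq> 0" using nz[of ?M] by (simp del: power_Suc)
  ultimately have "?S = 1 / (qpoch z p (Suc N) * qpoch y p (Suc N)) / ?c"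
    by (metis nonzero_mult_div_cancel_left)
  then show ?case
    by (simp only: qpoch_Suc[of _ _ ?M] divide_divide_eq_left ac_simps)
qed

subsection \<open>The Jacobi triple product\<close>

text \<open>The finite q-binomial theorem, by induction through the q-Pascal rule. The bracket of
  three Pochhammer symbols is the Gaussian binomial coefficient.\<close>

lemma q_binomial:
  assumes "norm p < 1"
  shows "qpoch a p M = (\<Sum>j<Suc M. (-1) ^ j * p ^ (j choose 2) * a ^ j
           * (qpoch p p M * inv_qpoch p j * inv_qpoch p (M - j)))"
proof (induction M)
  case 0
  then show ?case by (simp add: inv_qpoch_def binomial_eq_0)
next
  case (Suc M)
  define w where "w j = (-1) ^ j * p ^ (j choose 2) * a ^ j" for j
  define g where "g M j = qpoch p p M * inv_qpoch p j * inv_qpoch p (M - j)" for M j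
  \<comment> \<open>\<open>A\<close> and \<open>B\<close> are the two terms of the q-Pascal rule,
    set to 0 at the ends where truncated subtraction would give a wrong value.\<close>
  define A where "A j = (if j \<le> M then g M j else 0)" for j
  define B where "B j = (if j = 0 then 0 else p ^ (Suc M - j) * g M (j - 1))" for j
  have g: "g (Suc M) j = A j + B j" if "j < Suc (Suc M)" for j
  proof -
    have "j = 0 \<or> (\<exists>i<M. j = Suc i) \<or> j = Suc M"
      using that by (cases j) (auto simp: less_Suc_eq)
    then consider "j = 0" | i where "j = Suc i" "i < M" | "j = Suc M"
      by blast
    then show ?thesis
    proof cases
      case 1
      have "inv_qpoch p M = (1 - p ^ Suc M) * inv_qpoch p (Suc M)"
        by (rule inv_qpoch_Suc[OF assms])
      with 1 show ?thesis by (simp add: g_def A_def B_def qpoch_Suc)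
    next
      case 2
      then obtain m where M: "M = Suc (i + m)" using less_imp_Suc_add by blast
      have e: "inv_qpoch p i = (1 - p ^ Suc i) * inv_qpoch p (Suc i)"
        "inv_qpoch p m = (1 - p ^ Suc m) * inv_qpoch p (Suc m)"
        by (rule inv_qpoch_Suc[OF assms])+
      have d: "Suc M - j = Suc m" "M - j = m" "M - i = Suc m" "j \<le> M" "j - 1 = i" "j \<noteq> 0"
        using 2 M by auto
      have "1 - p ^ Suc M = (1 - p ^ Suc m) + p ^ Suc m * (1 - p ^ Suc i)"
        by (simp add: M power_add algebra_simps)
      then have "qpoch p p (Suc M) = qpoch p p M * ((1 - p ^ Suc m) + p ^ Suc m * (1 - p ^ Suc i))"
        by (simp only: qpoch_self_Suc)
      then have "g (Suc M) j = qpoch p p M * ((1 - p ^ Suc m) + p ^ Suc m * (1 - p ^ Suc i))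
          * inv_qpoch p (Suc i) * inv_qpoch p (Suc m)"
        by (simp only: g_def d 2(1)[symmetric])
      moreover have "A j = qpoch p p M * inv_qpoch p (Suc i) * ((1 - p ^ Suc m) * inv_qpoch p (Suc m))"
        unfolding A_def g_def d(2) e(2)[symmetric] using d(4) 2(1) by simp
      moreover have "B j = p ^ Suc m * (qpoch p p M * ((1 - p ^ Suc i) * inv_qpoch p (Suc i))
          * inv_qpoch p (Suc m))"
        unfolding B_def g_def d(1,3,5) e(1)[symmetric] using d(6) by simp
      ultimately show ?thesis
        by (simp only: distrib_left distrib_right mult_ac)
    next
      case 3
      have "inv_qpoch p M = (1 - p ^ Suc M) * inv_qpoch p (Suc M)"
        by (rule inv_qpoch_Suc[OF assms])
      with 3 show ?thesis by (simp add: g_def A_def B_def qpoch_Suc)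
    qed
  qed
  \<comment> \<open>After the shift \<open>j = Suc i\<close> the second Pascal term is
    \<open>- a * p ^ M\<close> times the old sum, so both together produce the new factor
    \<open>1 - a * p ^ M\<close>.\<close>
  have wB: "w (Suc i) * B (Suc i) = - (a * p ^ M) * (w i * g M i)" if "i < Suc M" for i
  proof -
    have "p ^ (Suc i choose 2) * p ^ (M - i) = p ^ M * p ^ (i choose 2)"
      using that by (simp add: Suc_choose_two add.commute flip: power_add)
    then show ?thesis
      by (simp add: w_def B_def algebra_simps)
  qed
  have "(\<Sum>j<Suc (Suc M). w j * g (Suc M) j)
      = (\<Sum>j<Suc (Suc M). w j * A j) + (\<Sum>j<Suc (Suc M). w j * B j)"
    unfolding sum.distrib[symmetric] by (intro sum.cong) (auto simp: g distrib_left)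
  also have "(\<Sum>j<Suc (Suc M). w j * A j) = (\<Sum>j<Suc M. w j * g M j)"
    by (simp add: A_def)
  also have "(\<Sum>j<Suc (Suc M). w j * B j) = (\<Sum>i<Suc M. - (a * p ^ M) * (w i * g M i))"
    unfolding sum.lessThan_Suc_shift[of _ "Suc M"] using wB by (simp add: B_def)
  also have "\<dots> = - (a * p ^ M) * (\<Sum>i<Suc M. w i * g M i)"
    by (simp only: sum_distrib_left)
  finally show ?case
    using Suc.IH unfolding w_def[symmetric] g_def[symmetric] by (simp add: qpoch_Suc algebra_simps)
qed

lemma two_times_choose_two: "2 * (n choose 2) + n = n * n"
  by (induction n) (simp_all add: Suc_choose_two)

lemma sum_lessThan_add:
  fixes h :: "nat \<Rightarrow> 'a::comm_monoid_add"
  shows "(\<Sum>j<m + n. h j) = (\<Sum>j<m. h j) + (\<Sum>j<n. h (m + j))"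
  by (induction n) (simp_all add: ac_simps)

lemma qpoch_add: "qpoch a p (m + n) = qpoch a p m * qpoch (a * p ^ m) p n"
  by (induction n) (simp_all add: qpoch_Suc power_add mult.assoc)

text \<open>Factor by factor, \<open>p^k * (1 - z / p^k) = - z * (1 - y * p^(k-1))\<close> for
  \<open>k\<close> from 1 to \<open>N\<close>, because \<open>p / z = y\<close>.\<close>

lemma qpoch_reverse:
  assumes "z \<noteq> 0" "p \<noteq> 0" "z * y = p"
  shows "p ^ (Suc N choose 2) * qpoch (z / p ^ N) p N = (- z) ^ N * qpoch y p N"
proof (induction N)
  case (Suc N)
  have head: "qpoch (z / p ^ Suc N) p (Suc N) = (1 - z / p ^ Suc N) * qpoch (z / p ^ N) p N"
    using qpoch_add[of "z / p ^ Suc N" p 1 N] assms by (simp add: qpoch_def)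
  have "p ^ Suc N * (1 - z / p ^ Suc N) = - z * (1 - y * p ^ N)"
    using assms by (simp add: field_simps)
  moreover have "p ^ (Suc (Suc N) choose 2) * qpoch (z / p ^ Suc N) p (Suc N)
      = (p ^ Suc N * (1 - z / p ^ Suc N)) * (p ^ (Suc N choose 2) * qpoch (z / p ^ N) p N)"
    unfolding Suc_choose_two[of "Suc N"] power_add head by (simp only: mult_ac)
  ultimately have "p ^ (Suc (Suc N) choose 2) * qpoch (z / p ^ Suc N) p (Suc N)
      = (- z * (1 - y * p ^ N)) * (p ^ (Suc N choose 2) * qpoch (z / p ^ N) p N)"
    by (simp only:)
  then show ?case
    unfolding Suc.IH by (simp add: qpoch_Suc)
qed (simp add: binomial_eq_0)

text \<open>For \<open>z y = p\<close>, again the terms of indices \<open>n\<close> and \<open>- 1 - n\<close> of the bilateral series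
  \<open>\<Sum> (-1)\<^sup>n z\<^bsup>-n\<^esup> p\<^bsup>n(n+1)/2\<^esup>\<close>.\<close>

definition theta_term :: "complex \<Rightarrow> complex \<Rightarrow> complex \<Rightarrow> nat \<Rightarrow> complex" where
  "theta_term p z y n = (-1) ^ n * p ^ (n choose 2) * y ^ n * (1 - z ^ (2 * n + 1))"

text \<open>Take \<open>a = z / p ^ N\<close> and \<open>2 * N + 1\<close> factors in
  \<open>q_binomial\<close>. By \<open>qpoch_reverse\<close> the factors with negative powers of
  \<open>p\<close> become the product in \<open>y\<close>. On the other side the terms
  \<open>j = N - n\<close> and \<open>j = Suc N + n\<close> carry equal weights and combine to
  \<open>theta_term p z y n\<close>.\<close>

lemma jacobi_triple_product_finite:
  assumes p: "norm p < 1" "p \<noteq> 0" and zy: "z * y = p"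
  shows "qpoch z p (Suc N) * qpoch y p N * inv_qpoch p (2 * N + 1)
    = (\<Sum>n<Suc N. theta_term p z y n * inv_qpoch p (N - n) * inv_qpoch p (Suc N + n))"
proof -
  have z: "z \<noteq> 0" using assms by auto
  define K where "K = qpoch p p (2 * N + 1)"
  have K: "K \<noteq> 0" using qpoch_nonzero[OF p(1,1)] by (simp add: K_def)
  define r where "r = inv_qpoch p"
  define T where "T = Suc N choose 2"
  define w where "w j = (-1) ^ j * p ^ (j choose 2) * (z / p ^ N) ^ j" for j
  define h where "h j = w j * (K * r j * r (2 * N + 1 - j))" for j
  have idx: "2 * N + 1 - (N - n) = Suc N + n" "2 * N + 1 - (Suc N + n) = N - n" if "n < Suc N" for n
    using that by auto
  have A: "p ^ T * (w (N - n) + w (Suc N + n)) = (- z) ^ N * theta_term p z y n" if "n < Suc N" for n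
  proof -
    obtain m where N: "N = n + m" using \<open>n < Suc N\<close> by (metis le_iff_add less_Suc_eq_le)
    have yn: "y ^ n * z ^ n = p ^ n"
      using zy by (metis mult.commute power_mult_distrib)
    have "T + (m choose 2) = N * m + (n choose 2) + n"
      using two_times_choose_two[of m]
      unfolding T_def N by (simp add: Suc_choose_two add_choose_two algebra_simps)
    then have e1: "p ^ T * p ^ (m choose 2) = p ^ (N * m) * p ^ (n choose 2) * p ^ n"
      by (simp only: flip: power_add)
    have "T + (Suc N + n choose 2) = N * (Suc N + n) + (n choose 2) + n"
      using two_times_choose_two[of N]
      unfolding T_def by (simp only: Suc_choose_two add_choose_two) (simp add: algebra_simps)
    then have e2: "p ^ T * p ^ (Suc N + n choose 2) = p ^ (N * (Suc N + n)) * p ^ (n choose 2) * p ^ n"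
      by (simp only: flip: power_add)
    have "p ^ T * w (N - n) = (- 1) ^ m * (p ^ T * p ^ (m choose 2)) * z ^ m / p ^ (N * m)"
      by (simp add: w_def N power_divide power_mult)
    also have "\<dots> = (- 1) ^ m * z ^ m * p ^ (n choose 2) * (y ^ n * z ^ n)"
      unfolding e1 yn using p by simp
    finally have 1: "p ^ T * w (N - n) = (- z) ^ N * ((-1) ^ n * p ^ (n choose 2) * y ^ n)"
      unfolding N by (simp add: power_minus[of z] power_add)
    have "p ^ T * w (Suc N + n) = (- 1) ^ (Suc N + n) * (p ^ T * p ^ (Suc N + n choose 2)) * z ^ (Suc N + n) / p ^ (N * (Suc N + n))"
      by (simp only: w_def power_divide power_mult) simp
    also have "\<dots> = (- 1) ^ (Suc N + n) * z ^ (Suc N + n) * p ^ (n choose 2) * (y ^ n * z ^ n)"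
      unfolding e2 yn using p by simp
    finally have 2: "p ^ T * w (Suc N + n) = - ((- z) ^ N * ((-1) ^ n * p ^ (n choose 2) * y ^ n * z ^ (2 * n + 1)))"
      by (simp add: power_minus[of z] power_add mult_2)
    show ?thesis
      unfolding distrib_left 1 2 theta_term_def by (simp add: algebra_simps)
  qed
  have "qpoch (z / p ^ N) p (N + Suc N) = qpoch (z / p ^ N) p N * qpoch z p (Suc N)"
    unfolding qpoch_add using p by simp
  then have "p ^ T * qpoch (z / p ^ N) p (2 * N + 1) = (- z) ^ N * (qpoch y p N * qpoch z p (Suc N))"
    using qpoch_reverse[OF z p(2) zy, of N] by (simp add: T_def mult_2)
  moreover have "qpoch (z / p ^ N) p (2 * N + 1) = (\<Sum>j<Suc (2 * N + 1). h j)"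
    unfolding q_binomial[OF p(1), of "z / p ^ N" "2 * N + 1"] h_def w_def K_def r_def ..
  moreover have "(\<Sum>j<Suc (2 * N + 1). h j) = (\<Sum>n<Suc N. h (N - n) + h (Suc N + n))"
  proof -
    have "(\<Sum>j<Suc (2 * N + 1). h j) = (\<Sum>j<Suc N. h j) + (\<Sum>n<Suc N. h (Suc N + n))"
      using sum_lessThan_add[of h "Suc N" "Suc N"] by (simp only: mult_2 add_Suc_right add_Suc add_0_right One_nat_def)
    also have "(\<Sum>j<Suc N. h j) = (\<Sum>n<Suc N. h (N - n))"
      using sum.nat_diff_reindex[of h "Suc N"] by (simp del: sum.lessThan_Suc)
    finally show ?thesis by (simp only: sum.distrib)
  qed
  moreover have "(\<Sum>n<Suc N. h (N - n) + h (Suc N + n))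
      = (\<Sum>n<Suc N. (w (N - n) + w (Suc N + n)) * (K * r (N - n) * r (Suc N + n)))"
  proof (rule sum.cong[OF refl])
    fix n assume "n \<in> {..<Suc N}"
    then have n: "n < Suc N" by simp
    show "h (N - n) + h (Suc N + n) = (w (N - n) + w (Suc N + n)) * (K * r (N - n) * r (Suc N + n))"
      unfolding h_def idx[OF n] by (simp only: algebra_simps)
  qed
  ultimately have "(- z) ^ N * (qpoch y p N * qpoch z p (Suc N))
      = p ^ T * (\<Sum>n<Suc N. (w (N - n) + w (Suc N + n)) * (K * r (N - n) * r (Suc N + n)))"
    by (simp only:)
  also have "\<dots> = (\<Sum>n<Suc N. p ^ T * (w (N - n) + w (Suc N + n)) * (K * r (N - n) * r (Suc N + n)))"
    by (simp only: sum_distrib_left mult.assoc)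
  also have "\<dots> = (\<Sum>n<Suc N. ((- z) ^ N * theta_term p z y n) * (K * r (N - n) * r (Suc N + n)))"
    by (intro sum.cong) (simp_all only: A lessThan_iff)
  also have "\<dots> = (- z) ^ N * K * (\<Sum>n<Suc N. theta_term p z y n * r (N - n) * r (Suc N + n))"
    by (simp add: sum_distrib_left ac_simps del: sum.lessThan_Suc)
  finally have S: "qpoch y p N * qpoch z p (Suc N)
      = K * (\<Sum>n<Suc N. theta_term p z y n * r (N - n) * r (Suc N + n))" (is "_ = K * ?S")
    using z by simp
  have Kr: "K * r (2 * N + 1) = 1"
    using K by (simp add: r_def inv_qpoch_def K_def)
  have "qpoch z p (Suc N) * qpoch y p N * r (2 * N + 1) = (qpoch y p N * qpoch z p (Suc N)) * r (2 * N + 1)"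
    by (simp only: mult_ac)
  also have "\<dots> = (K * r (2 * N + 1)) * ?S"
    unfolding S by (simp only: mult_ac)
  also have "\<dots> = ?S"
    unfolding Kr by (rule mult_1_left)
  finally show ?thesis
    unfolding r_def .
qed

section \<open>Infinite products and series as limits of the finite identities\<close>

lemma norm_one_minus_mult_power_ge:
  fixes a p :: complex
  assumes "norm p < 1"
  shows "1 - norm a \<le> norm (1 - a * p ^ n)"
proof -
  have "norm (a * p ^ n) \<le> norm a * 1"
    unfolding norm_mult norm_power using assms by (intro mult_left_mono power_le_one) auto
  then show ?thesis
    using norm_triangle_ineq2[of 1 "a * p ^ n"] by simp
qed

lemma norm_one_minus_power_le:
  fixes p :: complex
  assumes "norm p \<le> 1"
  shows "norm (1 - p ^ n) \<le> 2"
proof -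
  have "norm (p ^ n) \<le> 1"
    unfolding norm_power using assms by (intro power_le_one) auto
  then show ?thesis
    using norm_triangle_ineq4[of 1 "p ^ n"] by simp
qed

lemma summable_theta_coeff:
  assumes p: "norm p < 1" and z: "norm z < 1" and y: "norm y < 1"
  shows "summable (\<lambda>n. norm (theta_coeff p z y n))"
proof -
  let ?c = "2 / ((1 - norm z) * (1 - norm y))"
  have "summable (\<lambda>n. norm p ^ n * ?c)"
    using p by (intro summable_mult2 summable_geometric) auto
  then show ?thesis
  proof (rule summable_comparison_test'[where N = 0])
    fix n
    have "norm p ^ (Suc n choose 2) \<le> norm p ^ n"
      using p by (intro power_decreasing) (auto simp: Suc_choose_two)
    moreover have "norm (1 - p ^ (2 * n + 1)) \<le> 2"
      using p by (intro norm_one_minus_power_le) auto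
    moreover have "(1 - norm z) * (1 - norm y) \<le> norm (1 - z * p ^ n) * norm (1 - y * p ^ n)"
      using z y by (intro mult_mono norm_one_minus_mult_power_ge p) auto
    ultimately have "norm p ^ (Suc n choose 2) * norm (1 - p ^ (2 * n + 1))
        / (norm (1 - z * p ^ n) * norm (1 - y * p ^ n)) \<le> norm p ^ n * 2 / ((1 - norm z) * (1 - norm y))"
      using z y by (intro frac_le mult_mono norm_one_minus_mult_power_ge p) auto
    then show "norm (norm (theta_coeff p z y n)) \<le> norm p ^ n * ?c"
      by (simp add: theta_coeff_def norm_mult norm_divide norm_power)
  qed
qed

text \<open>The limit of \<open>theta_bailey_pair\<close>: the partial fraction (Lambert) series of
  the reciprocal of a theta product.\<close>

lemma theta_reciprocal:
  assumes p: "norm p < 1" and z: "norm z < 1" and y: "norm y < 1" and zy: "z * y = p"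
  shows "theta_coeff p z y sums (qpoch_inf p p ^ 2 / (qpoch_inf z p * qpoch_inf y p))"
proof -
  have s: "summable (\<lambda>n. norm (theta_coeff p z y n))"
    by (rule summable_theta_coeff[OF p z y])
  have L1: "(\<lambda>N. 1 / (qpoch z p (Suc N) * qpoch y p (Suc N)))
      \<longlonglongrightarrow> 1 / (qpoch_inf z p * qpoch_inf y p)"
    using qpoch_inf_nonzero[OF z p] qpoch_inf_nonzero[OF y p]
    by (intro tendsto_divide tendsto_mult tendsto_const LIMSEQ_Suc[OF qpoch_LIMSEQ[OF p]]) auto
  have L2: "(\<lambda>N. 1 / (qpoch z p (Suc N) * qpoch y p (Suc N)))
      \<longlonglongrightarrow> suminf (theta_coeff p z y) / qpoch_inf p p ^ 2"
    using LIMSEQ_Suc[OF inv_qpoch_kernel_LIMSEQ[OF p s]]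
    unfolding theta_bailey_pair[OF p z y zy] by (simp del: sum.lessThan_Suc)
  have "suminf (theta_coeff p z y) / qpoch_inf p p ^ 2 = 1 / (qpoch_inf z p * qpoch_inf y p)"
    using LIMSEQ_unique[OF L2 L1] .
  then have "suminf (theta_coeff p z y) = qpoch_inf p p ^ 2 / (qpoch_inf z p * qpoch_inf y p)"
    using qpoch_inf_nonzero[OF p p] by (simp add: divide_eq_eq)
  then show ?thesis
    using summable_sums[OF summable_norm_cancel[OF s]] by simp
qed

text \<open>Bailey's lemma applied to \<open>theta_bailey_pair\<close>. With
  \<open>p = x ^ 6\<close> it serves both mock theta functions.\<close>

lemma appell_sums:
  assumes p: "norm p < 1" and z: "norm z < 1" and y: "norm y < 1" and zy: "z * y = p"
  shows "(\<lambda>n. theta_coeff p z y n * p ^ (n ^ 2 + n)) sums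
    (qpoch_inf p p * (\<Sum>N. p ^ (N ^ 2 + N) / (qpoch z p (Suc N) * qpoch y p (Suc N))))"
proof -
  have s: "summable (\<lambda>n. norm (theta_coeff p z y n))"
    by (rule summable_theta_coeff[OF p z y])
  have "(\<lambda>N. p ^ (N ^ 2 + N) * (1 / (qpoch z p (Suc N) * qpoch y p (Suc N)))) sums
      ((\<Sum>n. theta_coeff p z y n * p ^ (n ^ 2 + n)) / qpoch_inf p p)"
    by (rule bailey_sums[OF p s theta_bailey_pair[OF p z y zy]])
  then have "(\<Sum>n. theta_coeff p z y n * p ^ (n ^ 2 + n))
      = qpoch_inf p p * (\<Sum>N. p ^ (N ^ 2 + N) / (qpoch z p (Suc N) * qpoch y p (Suc N)))"
    using qpoch_inf_nonzero[OF p p] by (simp add: sums_iff field_simps)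
  moreover have "summable (\<lambda>n. theta_coeff p z y n * p ^ (n ^ 2 + n))"
  proof (rule summable_comparison_test'[OF s, where N = 0])
    fix n
    have "norm p ^ (n ^ 2 + n) \<le> 1" using p by (intro power_le_one) auto
    then show "norm (theta_coeff p z y n * p ^ (n ^ 2 + n)) \<le> norm (theta_coeff p z y n)"
      by (simp add: norm_mult norm_power mult_left_le)
  qed
  ultimately show ?thesis
    by (simp add: sums_iff)
qed

text \<open>The limit of \<open>jacobi_triple_product_finite\<close>. The bound on \<open>z\<close>
  admits \<open>z = -1\<close>, the value that produces the triangular numbers.\<close>

theorem jacobi_triple_product:
  assumes p: "norm p < 1" "p \<noteq> 0" and z: "norm z \<le> 1" and y: "norm y < 1" and zy: "z * y = p"
  shows "theta_term p z y sums (qpoch_inf z p * qpoch_inf y p * qpoch_inf p p)"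
proof -
  have s: "summable (\<lambda>n. norm (theta_term p z y n))"
  proof (rule summable_comparison_test'[where N = 0])
    show "summable (\<lambda>n. norm y ^ n * 2)"
      using y by (intro summable_mult2 summable_geometric) auto
    fix n
    have "norm p ^ (n choose 2) \<le> 1" using p by (intro power_le_one) auto
    then have "norm p ^ (n choose 2) * norm y ^ n * norm (1 - z ^ (2 * n + 1)) \<le> 1 * norm y ^ n * 2"
      by (intro mult_mono norm_one_minus_power_le z) auto
    then show "norm (norm (theta_term p z y n)) \<le> norm y ^ n * 2"
      by (simp add: theta_term_def norm_mult norm_power)
  qed
  have "strict_mono (\<lambda>N :: nat. 2 * N + 1)"
    by (auto simp: strict_mono_def)
  then have "(\<lambda>N. inv_qpoch p (2 * N + 1)) \<longlonglongrightarrow> 1 / qpoch_inf p p"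
    by (intro filterlim_compose[OF inv_qpoch_LIMSEQ[OF p(1)]] filterlim_subseq)
  then have L1: "(\<lambda>N. qpoch z p (Suc N) * qpoch y p N * inv_qpoch p (2 * N + 1))
      \<longlonglongrightarrow> qpoch_inf z p * qpoch_inf y p * (1 / qpoch_inf p p)"
    by (intro tendsto_mult LIMSEQ_Suc[OF qpoch_LIMSEQ[OF p(1)]] qpoch_LIMSEQ[OF p(1)])
  have L2: "(\<lambda>N. qpoch z p (Suc N) * qpoch y p N * inv_qpoch p (2 * N + 1))
      \<longlonglongrightarrow> suminf (theta_term p z y) / qpoch_inf p p ^ 2"
    using LIMSEQ_Suc[OF inv_qpoch_kernel_LIMSEQ[OF p(1) s]]
    unfolding jacobi_triple_product_finite[OF p zy] by (simp del: sum.lessThan_Suc)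
  have "suminf (theta_term p z y) / qpoch_inf p p ^ 2
      = qpoch_inf z p * qpoch_inf y p * (1 / qpoch_inf p p)"
    using LIMSEQ_unique[OF L2 L1] .
  then have "suminf (theta_term p z y) = qpoch_inf z p * qpoch_inf y p * qpoch_inf p p"
    using qpoch_inf_nonzero[OF p(1,1)] by (simp add: divide_eq_eq power2_eq_square)
  then show ?thesis
    using summable_sums[OF summable_norm_cancel[OF s]] by simp
qed

subsection \<open>Theta functions and the decomposition of the mock theta function\<close>

lemma euler_f_power: "euler_f k (q ^ m) = euler_f (m * k) q"
  by (simp add: euler_f_def power_mult)

lemma norm_power_less_one:
  fixes q :: complex
  assumes "norm q < 1" "0 < k"
  shows "norm (q ^ k) < 1"
  using assms by (simp add: norm_power power_less_one_iff)

lemma euler_f_nonzero: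
  assumes "norm q < 1" "0 < k"
  shows "euler_f k q \<noteq> 0"
  unfolding euler_f_def by (intro qpoch_inf_nonzero norm_power_less_one assms)

lemma qpoch_inf_minus_self:
  assumes "norm q < 1"
  shows "qpoch_inf (- q) q = euler_f 2 q / euler_f 1 q"
  using qpoch_inf_mult_minus[OF assms, of q] euler_f_nonzero[OF assms, of 1]
  by (simp add: euler_f_def field_simps)

text \<open>Gauss's series for psi: the triple product at \<open>z = -1\<close>,
  \<open>y = - x\<close>. There the terms of indices \<open>n\<close> and \<open>- 1 - n\<close>
  coincide, and the factor 2 this causes matches the first factor of
  \<open>qpoch_inf (-1) x\<close>.\<close>

lemma triangular_number_sums:
  assumes x: "norm x < 1" "x \<noteq> 0"
  shows "(\<lambda>n. x ^ (Suc n choose 2)) sums (euler_f 2 x ^ 2 / euler_f 1 x)"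
proof -
  have "theta_term x (-1) (- x) sums (qpoch_inf (-1) x * qpoch_inf (- x) x * qpoch_inf x x)"
    using x by (intro jacobi_triple_product) auto
  moreover have "qpoch_inf (-1) x = 2 * qpoch_inf (- x) x"
    using qpoch_inf_split_head[OF x(1), of "-1"] by simp
  ultimately have "theta_term x (-1) (- x) sums (2 * (euler_f 2 x ^ 2 / euler_f 1 x))"
    using euler_f_nonzero[OF x(1), of 1]
    by (simp add: qpoch_inf_minus_self[OF x(1)] euler_f_def power2_eq_square)
  moreover have eq: "theta_term x (-1) (- x) n = 2 * x ^ (Suc n choose 2)" for n
  proof -
    have "(-1) ^ n * (- x) ^ n = x ^ n"
      by (simp flip: power_mult_distrib)
    then have "(-1) ^ n * x ^ (n choose 2) * (- x) ^ n = x ^ (Suc n choose 2)"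
      by (simp add: Suc_choose_two power_add ac_simps)
    then show ?thesis
      by (simp add: theta_term_def)
  qed
  ultimately have "(\<lambda>n. 2 * x ^ (Suc n choose 2)) sums (2 * (euler_f 2 x ^ 2 / euler_f 1 x))"
    using sums_cong[OF eq] by simp
  then show ?thesis
    by (subst (asm) sums_mult_iff) auto
qed

lemma qpoch_inf_trisection:
  assumes "norm p < 1"
  shows "qpoch_inf a p = qpoch_inf a (p ^ 3) * qpoch_inf (a * p) (p ^ 3) * qpoch_inf (a * p ^ 2) (p ^ 3)"
  using qpoch_inf_multisection[OF assms, of 3 a] by (simp add: numeral_3_eq_3 ac_simps power2_eq_square)

text \<open>The triple product with base \<open>q ^ 3\<close>, \<open>z = q\<close> and
  \<open>y = q ^ 2\<close>: its three products run over the residue classes modulo 3 and recombine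
  to \<open>euler_f 1 q\<close>.\<close>

lemma pentagonal_number_sums:
  assumes q: "norm q < 1" "q \<noteq> 0"
  shows "(\<lambda>n. (-1) ^ n * q ^ (3 * (n choose 2) + 2 * n) * (1 - q ^ (2 * n + 1))) sums euler_f 1 q"
proof -
  have "theta_term (q ^ 3) q (q ^ 2)
      sums (qpoch_inf q (q ^ 3) * qpoch_inf (q ^ 2) (q ^ 3) * qpoch_inf (q ^ 3) (q ^ 3))"
    using q by (intro jacobi_triple_product norm_power_less_one)
      (auto simp: power2_eq_square power3_eq_cube)
  moreover have "qpoch_inf q (q ^ 3) * qpoch_inf (q ^ 2) (q ^ 3) * qpoch_inf (q ^ 3) (q ^ 3) = euler_f 1 q"
    using qpoch_inf_trisection[OF q(1), of q]
    by (simp add: euler_f_def power2_eq_square power3_eq_cube ac_simps)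
  moreover have "theta_term (q ^ 3) q (q ^ 2)
      = (\<lambda>n. (-1) ^ n * q ^ (3 * (n choose 2) + 2 * n) * (1 - q ^ (2 * n + 1)))"
    by (simp only: theta_term_def [abs_def] power_add power_mult mult.assoc)
  ultimately show ?thesis by simp
qed

text \<open>Ramanujan's theta function f(q, q^2), the pentagonal series without signs. The product
  side is that of \<open>qpoch_inf (- q) q\<close> with the class of multiples of 3
  replaced.\<close>

lemma theta_1_2_sums:
  assumes q: "norm q < 1" "q \<noteq> 0"
  shows "(\<lambda>n. q ^ (3 * (n choose 2) + 2 * n) * (1 + q ^ (2 * n + 1)))
           sums (euler_f 2 q * euler_f 3 q ^ 2 / (euler_f 1 q * euler_f 6 q))"
proof -
  have q3: "norm (q ^ 3) < 1"
    using q by (intro norm_power_less_one) auto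
  have "theta_term (q ^ 3) (- q) (- (q ^ 2))
      sums (qpoch_inf (- q) (q ^ 3) * qpoch_inf (- (q ^ 2)) (q ^ 3) * qpoch_inf (q ^ 3) (q ^ 3))"
    using q q3 norm_power_less_one[of q 2] by (intro jacobi_triple_product)
      (auto simp: power2_eq_square power3_eq_cube)
  moreover have "qpoch_inf (- q) (q ^ 3) * qpoch_inf (- (q ^ 2)) (q ^ 3) * qpoch_inf (q ^ 3) (q ^ 3)
      = euler_f 2 q * euler_f 3 q ^ 2 / (euler_f 1 q * euler_f 6 q)"
  proof -
    have "qpoch_inf (- q) (q ^ 3) * qpoch_inf (- (q ^ 2)) (q ^ 3) * qpoch_inf (- (q ^ 3)) (q ^ 3)
        = euler_f 2 q / euler_f 1 q"
      using qpoch_inf_trisection[OF q(1), of "- q"]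
      by (simp add: qpoch_inf_minus_self[OF q(1)] power2_eq_square power3_eq_cube ac_simps)
    moreover have "qpoch_inf (- (q ^ 3)) (q ^ 3) = euler_f 6 q / euler_f 3 q"
      unfolding qpoch_inf_minus_self[OF q3] euler_f_power by simp
    moreover have "qpoch_inf (q ^ 3) (q ^ 3) = euler_f 3 q"
      by (simp add: euler_f_def)
    ultimately show ?thesis
      using euler_f_nonzero[OF q(1), of 1] euler_f_nonzero[OF q(1), of 3] euler_f_nonzero[OF q(1), of 6]
      by (simp add: field_simps power2_eq_square)
  qed
  moreover have eq: "theta_term (q ^ 3) (- q) (- (q ^ 2)) n
      = q ^ (3 * (n choose 2) + 2 * n) * (1 + q ^ (2 * n + 1))" for n
  proof -
    have "(-1) ^ n * (- (q ^ 2)) ^ n = q ^ (2 * n)"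
      by (simp add: power_mult flip: power_mult_distrib)
    then have "(-1) ^ n * (q ^ 3) ^ (n choose 2) * (- (q ^ 2)) ^ n = q ^ (3 * (n choose 2) + 2 * n)"
      by (simp add: power_add power_mult ac_simps)
    then show ?thesis
      by (simp add: theta_term_def)
  qed
  ultimately show ?thesis using sums_cong[OF eq] by simp
qed

lemma three_times_choose_two: "(3 * n) choose 2 = 9 * (n choose 2) + 3 * n"
  using two_times_choose_two[of "3 * n"] two_times_choose_two[of n] by simp

lemma sums_group_3:
  fixes f :: "nat \<Rightarrow> complex"
  assumes "f sums s"
  shows "(\<lambda>n. f (3 * n) + f (3 * n + 1) + f (3 * n + 2)) sums s"
  using sums_group[OF assms, of 3] by (simp add: numeral_3_eq_3 ac_simps)

text \<open>Triangular numbers of index 1 modulo 3 are one more than 9 times a triangular number.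
  Those of index 0 or 2 are 3 times the generalized pentagonal numbers.\<close>

lemma triangular_trisection:
  assumes x: "norm x < 1" "x \<noteq> 0"
  shows "euler_f 2 x ^ 2 / euler_f 1 x
    = euler_f 6 x * euler_f 9 x ^ 2 / (euler_f 3 x * euler_f 18 x) + x * (euler_f 18 x ^ 2 / euler_f 9 x)"
proof -
  have x3: "norm (x ^ 3) < 1" "x ^ 3 \<noteq> 0" and x9: "norm (x ^ 9) < 1" "x ^ 9 \<noteq> 0"
    using x by (auto intro: norm_power_less_one)
  let ?f = "\<lambda>n. x ^ (Suc n choose 2)"
  have "?f (3 * n) + ?f (3 * n + 1) + ?f (3 * n + 2)
      = (x ^ 3) ^ (3 * (n choose 2) + 2 * n) * (1 + (x ^ 3) ^ (2 * n + 1)) + x * (x ^ 9) ^ (Suc n choose 2)" for n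
  proof -
    have "Suc (3 * n) choose 2 = 3 * (3 * (n choose 2) + 2 * n)"
      "Suc (3 * n + 1) choose 2 = Suc (9 * (Suc n choose 2))"
      "Suc (3 * n + 2) choose 2 = 3 * (3 * (n choose 2) + 2 * n + (2 * n + 1))"
      by (simp_all add: Suc_choose_two three_times_choose_two)
    then show ?thesis
      by (simp only: distrib_left mult_1_right add_ac flip: power_mult power_add power_Suc)
  qed
  then have "(\<lambda>n. (x ^ 3) ^ (3 * (n choose 2) + 2 * n) * (1 + (x ^ 3) ^ (2 * n + 1)) + x * (x ^ 9) ^ (Suc n choose 2))
      sums (euler_f 2 x ^ 2 / euler_f 1 x)"
    using sums_group_3[OF triangular_number_sums[OF x]] by simp
  moreover have "(\<lambda>n. (x ^ 3) ^ (3 * (n choose 2) + 2 * n) * (1 + (x ^ 3) ^ (2 * n + 1)) + x * (x ^ 9) ^ (Suc n choose 2))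
      sums (euler_f 6 x * euler_f 9 x ^ 2 / (euler_f 3 x * euler_f 18 x) + x * (euler_f 18 x ^ 2 / euler_f 9 x))"
    using theta_1_2_sums[OF x3] triangular_number_sums[OF x9] unfolding euler_f_power
    by (intro sums_add sums_mult) simp_all
  ultimately show ?thesis
    by (rule sums_unique2)
qed

lemma xi_decomposition:
  assumes x: "norm x < 1" "x \<noteq> 0"
  shows "mock_xi x = x ^ 2 * mock_omega (x ^ 3) + (euler_f 2 x ^ 2 / euler_f 1 x) ^ 2 / euler_f 6 x"
proof -
  have nx: "norm (x ^ k) < 1" if "0 < k" for k
    by (rule norm_power_less_one[OF x(1) that])
  define \<xi> where "\<xi> = (\<Sum>N. (x ^ 6) ^ (N ^ 2 + N) / (qpoch x (x ^ 6) (Suc N) * qpoch (x ^ 5) (x ^ 6) (Suc N)))"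
  define \<omega> where "\<omega> = (\<Sum>N. (x ^ 6) ^ (N ^ 2 + N) / (qpoch (x ^ 3) (x ^ 6) (Suc N) * qpoch (x ^ 3) (x ^ 6) (Suc N)))"
  \<comment> \<open>\<open>a\<close> and \<open>b\<close> are the Appell-Lerch series of xi and
    omega, \<open>c\<close> is the pentagonal series of \<open>euler_f 6 x\<close>, and
    \<open>d\<close> is the Lambert series of psi squared.\<close>
  define a where "a n = theta_coeff (x ^ 6) x (x ^ 5) n * (x ^ 6) ^ (n ^ 2 + n)" for n
  define b where "b n = theta_coeff (x ^ 6) (x ^ 3) (x ^ 3) n * (x ^ 6) ^ (n ^ 2 + n)" for n
  define c where "c n = (-1) ^ n * (x ^ 6) ^ (3 * (n choose 2) + 2 * n) * (1 - (x ^ 6) ^ (2 * n + 1))" for n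
  define d where "d = theta_coeff (x ^ 2) x x"
  have xi: "mock_xi x = 1 + 2 * x * \<xi>"
  proof -
    have eq: "xi_summand x (Suc N) = x * ((x ^ 6) ^ (N ^ 2 + N) / (qpoch x (x ^ 6) (Suc N) * qpoch (x ^ 5) (x ^ 6) (Suc N)))" for N
    proof -
      have "6 * Suc N ^ 2 - 6 * Suc N + 1 = Suc (6 * (N ^ 2 + N))"
        by (simp add: power2_eq_square)
      then show ?thesis
        unfolding xi_summand_def by (simp only: power_Suc power_mult times_divide_eq_right)
    qed
    have "summable (\<lambda>N. (x ^ 6) ^ (N ^ 2 + N) / (qpoch x (x ^ 6) (Suc N) * qpoch (x ^ 5) (x ^ 6) (Suc N)))"
      using summable_xi_summand[OF x(1)] x(2) unfolding eq by (subst (asm) summable_cmult_iff) auto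
    then have "(\<Sum>N. xi_summand x (Suc N)) = x * \<xi>"
      unfolding eq \<xi>_def by (rule suminf_mult)
    then show ?thesis
      by (simp add: mock_xi_def)
  qed
  have omega: "mock_omega (x ^ 3) = \<omega>"
    unfolding mock_omega_def \<omega>_def
    by (intro suminf_cong) (simp add: power2_eq_square algebra_simps flip: power_mult)
  have "a sums (euler_f 6 x * \<xi>)"
    unfolding a_def [abs_def] \<xi>_def euler_f_def
    using x nx by (intro appell_sums) (simp_all flip: power_Suc)
  moreover have "b sums (euler_f 6 x * \<omega>)"
    unfolding b_def [abs_def] \<omega>_def euler_f_def
    using x nx by (intro appell_sums) (simp_all flip: power_add)
  moreover have "c sums euler_f 6 x"
    using pentagonal_number_sums[of "x ^ 6"] x nx unfolding c_def [abs_def] euler_f_power by simp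
  ultimately have 1: "(\<lambda>n. c n + 2 * x * a n - x ^ 2 * b n)
      sums (euler_f 6 x + 2 * x * (euler_f 6 x * \<xi>) - x ^ 2 * (euler_f 6 x * \<omega>))"
    by (intro sums_add sums_diff sums_mult)
  have "d sums (euler_f 2 x ^ 2 / (qpoch_inf x (x ^ 2) * qpoch_inf x (x ^ 2)))"
    unfolding d_def euler_f_def
    using x nx[of 2] by (intro theta_reciprocal) (simp_all, simp add: power2_eq_square)
  moreover have "qpoch_inf x (x ^ 2) = euler_f 1 x / euler_f 2 x"
    using qpoch_inf_multisection[OF x(1), of 2 x] euler_f_nonzero[OF x(1), of 2]
    by (simp add: euler_f_def numeral_2_eq_2 field_simps)
  ultimately have 2: "d sums ((euler_f 2 x ^ 2 / euler_f 1 x) ^ 2)"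
    by (simp add: power2_eq_square)
  have "d (3 * n) + d (3 * n + 1) + d (3 * n + 2) = c n + 2 * x * a n - x ^ 2 * b n" for n
  proof -
    \<comment> \<open>\<open>u\<close>, \<open>v\<close>, \<open>w\<close> are
      \<open>x ^ (2 * m + 1)\<close> for \<open>m = 3 * n\<close>, \<open>3 * n + 1\<close>,
      \<open>3 * n + 2\<close>, and \<open>e\<close> is the sign and power of \<open>x\<close> in
      front of \<open>d (3 * n)\<close>.\<close>
    define u where "u = x ^ (6 * n + 1)"
    define v where "v = x ^ (6 * n + 3)"
    define w where "w = x ^ (6 * n + 5)"
    define e where "e = (-1) ^ n * x ^ (18 * (n choose 2) + 12 * n)"
    have nz: "1 - u \<noteq> 0" "1 - v \<noteq> 0" "1 - w \<noteq> 0"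
      using one_minus_mult_power_nonzero[OF nx x(1), of 1 "6 * n"]
        one_minus_mult_power_nonzero[OF nx x(1), of 3 "6 * n"]
        one_minus_mult_power_nonzero[OF nx x(1), of 5 "6 * n"]
      unfolding u_def v_def w_def by (simp_all add: power_add mult.commute)
    have uw: "x ^ (12 * n + 6) = u * w"
      unfolding u_def w_def power_add[symmetric] by (rule arg_cong[of _ _ "\<lambda>k. x ^ k"]) simp
    have sq: "n ^ 2 = 2 * (n choose 2) + n"
      using two_times_choose_two[of n] by (simp add: power2_eq_square)
    \<comment> \<open>Since \<open>z = y = x\<close>, the denominator is a square, and one of its
      factors cancels against the difference of squares in the numerator.\<close>
    have d: "d m = (-1) ^ m * x ^ (2 * (Suc m choose 2)) * ((1 + x ^ (2 * m + 1)) / (1 - x ^ (2 * m + 1)))" for m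
    proof -
      have t: "1 - x ^ (2 * m + 1) \<noteq> 0"
        using one_minus_mult_power_nonzero[OF x(1,1), of "2 * m"] by simp
      have cancel: "A * ((1 - t) * (1 + t)) / ((1 - t) * (1 - t)) = A * ((1 + t) / (1 - t))"
        if "1 - t \<noteq> 0" for A t :: complex
        using that by simp
      have "1 - (x ^ 2) ^ (2 * m + 1) = (1 - x ^ (2 * m + 1)) * (1 + x ^ (2 * m + 1))"
        by (simp add: algebra_simps power_mult_distrib power2_eq_square flip: power_add)
      moreover have "x * (x ^ 2) ^ m = x ^ (2 * m + 1)"
        by (simp flip: power_mult)
      ultimately show ?thesis
        unfolding d_def theta_coeff_def power_mult[of x 2 "Suc m choose 2"]
        using cancel[OF t] by (simp only:)
    qed
    have d0: "d (3 * n) = e * ((1 + u) / (1 - u))"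
      unfolding d e_def u_def by (simp add: Suc_choose_two three_times_choose_two minus_one_power_iff add.commute)
    have d1: "d (3 * n + 1) = - (e * x ^ (6 * n + 2) * ((1 + v) / (1 - v)))"
    proof -
      have "2 * (Suc (3 * n + 1) choose 2) = (18 * (n choose 2) + 12 * n) + (6 * n + 2)"
        "2 * (3 * n + 1) + 1 = 6 * n + 3"
        by (simp_all add: Suc_choose_two three_times_choose_two)
      moreover have "(-1) ^ (3 * n + 1) = - ((-1) ^ n :: complex)"
        by (simp add: minus_one_power_iff)
      ultimately show ?thesis
        unfolding d e_def v_def by (simp only: power_add[of x "18 * (n choose 2) + 12 * n"]) simp
    qed
    have d2: "d (3 * n + 2) = e * (u * w) * ((1 + w) / (1 - w))"
    proof -
      have "2 * (Suc (3 * n + 2) choose 2) = (18 * (n choose 2) + 12 * n) + (12 * n + 6)"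
        "2 * (3 * n + 2) + 1 = 6 * n + 5"
        by (simp_all add: Suc_choose_two three_times_choose_two)
      moreover have "(-1) ^ (3 * n + 2) = ((-1) ^ n :: complex)"
        by (simp add: minus_one_power_iff)
      ultimately show ?thesis
        unfolding d e_def w_def[symmetric] uw[symmetric]
        by (simp only: power_add[of x "18 * (n choose 2) + 12 * n"]) (simp add: w_def)
    qed
    have p: "(x ^ 6) ^ (3 * (n choose 2) + 2 * n) = x ^ (18 * (n choose 2) + 12 * n)"
      "(x ^ 6) ^ (2 * n + 1) = u * w"
      unfolding uw[symmetric] power_mult[symmetric] by (simp_all add: distrib_left add.commute)
    have r: "x * (x ^ 6) ^ n = u" "x ^ 5 * (x ^ 6) ^ n = w" "x ^ 3 * (x ^ 6) ^ n = v"
      unfolding u_def v_def w_def power_mult[symmetric] power_Suc[symmetric] power_add[symmetric]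
      by (simp_all add: add.commute)
    have t: "x ^ k * ((x ^ 6) ^ (Suc n choose 2) * (x ^ 6) ^ (n ^ 2 + n))
        = x ^ (18 * (n choose 2) + 12 * n) * x ^ (6 * n + k)" for k
      unfolding sq power_mult[symmetric] power_add[symmetric]
      by (rule arg_cong[of _ _ "\<lambda>k. x ^ k"]) (simp add: Suc_choose_two)
    have c: "c n = e * (1 - u * w)"
      unfolding c_def e_def p ..
    have a: "x * a n = e * u * ((1 - u * w) / ((1 - u) * (1 - w)))"
    proof -
      have "x * a n = (-1) ^ n * (x ^ 1 * ((x ^ 6) ^ (Suc n choose 2) * (x ^ 6) ^ (n ^ 2 + n)))
          * ((1 - u * w) / ((1 - u) * (1 - w)))"
        unfolding a_def theta_coeff_def r p by simp
      then show ?thesis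
        unfolding t e_def u_def by (simp only: mult.assoc)
    qed
    have b: "x ^ 2 * b n = e * x ^ (6 * n + 2) * ((1 + v) / (1 - v))"
    proof -
      have "u * w = v * v"
        unfolding uw[symmetric] v_def power_add[symmetric] by (rule arg_cong[of _ _ "\<lambda>k. x ^ k"]) simp
      then have "1 - u * w = (1 - v) * (1 + v)"
        by (simp add: algebra_simps)
      then have "(1 - u * w) / ((1 - v) * (1 - v)) = (1 + v) / (1 - v)"
        using nz by simp
      moreover have "x ^ 2 * b n = (-1) ^ n * (x ^ 2 * ((x ^ 6) ^ (Suc n choose 2) * (x ^ 6) ^ (n ^ 2 + n)))
          * ((1 - u * w) / ((1 - v) * (1 - v)))"
        unfolding b_def theta_coeff_def r p by simp
      ultimately show ?thesis
        unfolding t e_def by (simp only: mult.assoc)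
    qed
    \<comment> \<open>By \<open>d1\<close> and \<open>b\<close> the class of 1 is already the omega
      term. This identity turns the classes of 0 and 2 into the pentagonal term plus twice the xi
      term.\<close>
    have "(1 + u) / (1 - u) + u * w * ((1 + w) / (1 - w)) = (1 - u * w) + 2 * u * ((1 - u * w) / ((1 - u) * (1 - w)))"
    proof -
      \<comment> \<open>Writing \<open>s = 1 - s'\<close> and \<open>t = 1 - t'\<close> turns the
        denominators into plain variables, so that they can be cleared automatically.\<close>
      have pf: "1 - s \<noteq> 0 \<Longrightarrow> 1 - t \<noteq> 0 \<Longrightarrow> (1 + s) / (1 - s) + s * t * ((1 + t) / (1 - t))
          = (1 - s * t) + 2 * s * ((1 - s * t) / ((1 - s) * (1 - t)))" if "s = 1 - s'" "t = 1 - t'"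
        for s t s' t' :: complex
        unfolding that by (simp add: field_simps)
      show ?thesis
        by (rule pf[where s' = "1 - u" and t' = "1 - w"]) (use nz in simp_all)
    qed
    then have "e * ((1 + u) / (1 - u) + u * w * ((1 + w) / (1 - w))) = e * ((1 - u * w) + 2 * u * ((1 - u * w) / ((1 - u) * (1 - w))))"
      by (rule arg_cong)
    then show ?thesis
      unfolding mult.assoc[of 2 x] d0 d1 d2 a b c by (simp add: distrib_left mult.assoc mult.left_commute)
  qed
  then have "(\<lambda>n. c n + 2 * x * a n - x ^ 2 * b n) sums ((euler_f 2 x ^ 2 / euler_f 1 x) ^ 2)"
    using sums_group_3[OF 2] by simp
  from sums_unique2[OF this 1]
  have psi_sq: "(euler_f 2 x ^ 2 / euler_f 1 x) ^ 2 = euler_f 6 x * (1 + 2 * x * \<xi> - x ^ 2 * \<omega>)"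
    by (simp add: algebra_simps)
  have "euler_f 6 x \<noteq> 0"
    using x(1) by (intro euler_f_nonzero) auto
  then show ?thesis
    unfolding xi omega psi_sq by simp
qed

subsection \<open>Extracting the coefficients\<close>

text \<open>Square the trisected psi and divide by \<open>euler_f 6 x\<close>, which is
  \<open>euler_f 2 q\<close>: the three terms of the square are functions of \<open>q\<close> times
  1, \<open>x\<close> and \<open>x ^ 2\<close>. The omega term joins the last one.\<close>

lemma mock_xi_dissection:
  assumes x: "norm x < 1" "x \<noteq> 0" and q: "q = x ^ 3"
  shows "mock_xi x = euler_f 2 q * euler_f 3 q ^ 4 / (euler_f 1 q ^ 2 * euler_f 6 q ^ 2)
     + x * (2 * (euler_f 3 q * euler_f 6 q / euler_f 1 q))
     + x ^ 2 * (mock_omega q + euler_f 6 q ^ 4 / (euler_f 2 q * euler_f 3 q ^ 2))"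
proof -
  have e: "euler_f 6 x = euler_f 2 q" "euler_f 9 x = euler_f 3 q" "euler_f 3 x = euler_f 1 q"
    "euler_f 18 x = euler_f 6 q"
    unfolding q euler_f_power by simp_all
  have "norm q < 1" unfolding q using x(1) by (rule norm_power_less_one) simp
  then have nz: "euler_f 1 q \<noteq> 0" "euler_f 2 q \<noteq> 0" "euler_f 3 q \<noteq> 0" "euler_f 6 q \<noteq> 0"
    by (simp_all add: euler_f_nonzero)
  have sq: "(a * c ^ 2 / (b * d) + x * (d ^ 2 / c)) ^ 2 / a
      = a * c ^ 4 / (b ^ 2 * d ^ 2) + x * (2 * (c * d / b)) + x ^ 2 * (d ^ 4 / (a * c ^ 2))"
    if "a \<noteq> 0" "b \<noteq> 0" "c \<noteq> 0" "d \<noteq> 0" for a b c d :: complex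
    using that by (simp add: field_simps power2_eq_square power4_eq_xxxx)
  show ?thesis
    unfolding xi_decomposition[OF x] triangular_trisection[OF x] e q[symmetric]
      sq[OF nz(2,1,3,4)] by (simp add: distrib_left)
qed

section \<open>Limits of the right-hand sides at the origin\<close>

text \<open>The bound is uniform in \<open>n\<close>, so it passes to the infinite product, and it
  tends to 0 with \<open>p\<close>.\<close>

lemma qpoch_self_minus_one_le:
  assumes "norm p < 1"
  shows "norm (qpoch p p n - 1) \<le> exp (norm p / (1 - norm p)) - 1"
proof -
  have "norm ((\<Prod>k<n. 1 + - (p * p ^ k)) - 1) \<le> (\<Prod>k<n. 1 + norm (- (p * p ^ k))) - 1"
    by (rule norm_prod_minus1_le_prod_minus1)
  also have "(\<Prod>k<n. 1 + norm (- (p * p ^ k))) \<le> exp (\<Sum>k<n. norm (- (p * p ^ k)))"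
    by (rule prod_le_exp_sum) auto
  also have "(\<Sum>k<n. norm (- (p * p ^ k))) \<le> (\<Sum>k. norm p * norm p ^ k)"
    unfolding norm_minus_cancel norm_mult norm_power
    using assms by (intro sum_le_suminf summable_mult summable_geometric) auto
  also have "(\<Sum>k. norm p * norm p ^ k) = norm p / (1 - norm p)"
    using assms by (subst suminf_mult) (auto simp: suminf_geometric)
  finally show ?thesis
    by (simp add: qpoch_def)
qed

lemma euler_f_tendsto_0:
  assumes "0 < k"
  shows "(euler_f k \<longlongrightarrow> 1) (at 0)"
proof -
  have small: "eventually (\<lambda>q :: complex. norm q < r) (at 0)" if "0 < r" for r
    using that by (auto simp: eventually_at intro!: exI[of _ r])
  have bound: "norm (euler_f k q - 1) \<le> exp (norm (q ^ k) / (1 - norm (q ^ k))) - 1"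
    if "norm q < 1" for q
  proof -
    have "norm (q ^ k) < 1"
      using that assms by (rule norm_power_less_one)
    then have "(\<lambda>n. norm (qpoch (q ^ k) (q ^ k) n - 1)) \<longlonglongrightarrow> norm (euler_f k q - 1)"
      unfolding euler_f_def by (intro tendsto_norm tendsto_diff tendsto_const qpoch_LIMSEQ)
    then show ?thesis
      by (rule Lim_bounded) (use qpoch_self_minus_one_le \<open>norm (q ^ k) < 1\<close> in auto)
  qed
  have "((\<lambda>q :: complex. exp (norm (q ^ k) / (1 - norm (q ^ k))) - 1)
      \<longlongrightarrow> exp (norm ((0 :: complex) ^ k) / (1 - norm ((0 :: complex) ^ k))) - 1) (at 0)"
    using assms by (intro tendsto_intros) (auto simp: power_0_left)
  then have "((\<lambda>q. euler_f k q - 1) \<longlongrightarrow> 0) (at 0)"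
    using assms by (intro Lim_null_comparison[OF eventually_mono[OF small[of 1] bound]]) (auto simp: power_0_left)
  then show ?thesis
    by (rule LIM_zero_cancel)
qed

lemma mock_omega_tendsto_0: "(mock_omega \<longlongrightarrow> 1) (at 0)"
proof -
  define t where "t n q = q ^ (2 * n * (n + 1)) / qpoch q (q ^ 2) (n + 1) ^ 2" for n and q :: complex
  have "((\<lambda>q. \<Sum>n. t n q) \<longlongrightarrow> (\<Sum>n. t n 0)) (at 0)"
  proof (rule tannerys_theorem[where M = "\<lambda>n. 4 * (1 / 2) ^ n", THEN conjunct2, THEN conjunct2])
    fix n
    have "((\<lambda>q. q ^ (2 * n * (n + 1)) / (\<Prod>k<n + 1. 1 - q * (q ^ 2) ^ k) ^ 2)
        \<longlongrightarrow> 0 ^ (2 * n * (n + 1)) / (\<Prod>k<n + 1. 1 - 0 * (0 ^ 2) ^ k) ^ 2) (at (0 :: complex))"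
      by (intro tendsto_intros) auto
    then show "(t n \<longlongrightarrow> t n 0) (at 0)"
      unfolding t_def qpoch_def .
  next
    \<comment> \<open>Each factor of the denominator has norm at least 1/2, which costs at most
      \<open>4 ^ (n + 1)\<close>. The power of \<open>q\<close> pays for this up to the constant
      4.\<close>
    have bound: "norm (t n q) \<le> 4 * (1 / 2) ^ n" if "norm q < 1 / 2" for n q
    proof -
      have "((1 - 1 / 2) ^ (n + 1)) ^ 2 \<le> norm (qpoch (q ^ 1) (q ^ 2) (n + 1)) ^ 2"
        using that by (intro power_mono norm_qpoch_ge) auto
      moreover have "norm q ^ (2 * n * (n + 1)) \<le> (1 / 2) ^ (2 * n * (n + 1))"
        using that by (intro power_mono) auto
      ultimately have "norm (t n q) \<le> (1 / 2) ^ (2 * n * (n + 1)) / ((1 / 2) ^ (n + 1)) ^ 2"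
        unfolding t_def norm_divide norm_power by (intro frac_le) auto
      also have "2 * n * (n + 1) = 2 * (n * n) + 2 * n"
        by simp
      also have "(1 / 2 :: real) ^ (2 * (n * n) + 2 * n) / ((1 / 2) ^ (n + 1)) ^ 2 = 4 * (1 / 2) ^ (2 * (n * n))"
        by (simp add: power_add power_mult power_divide field_simps)
      also have "(1 / 2 :: real) ^ (2 * (n * n)) \<le> (1 / 2) ^ n"
        by (intro power_decreasing) auto
      finally show ?thesis by simp
    qed
    have "eventually (\<lambda>q :: complex. norm q < 1 / 2) (at 0)"
      by (auto simp: eventually_at intro!: exI[of _ "1 / 2"])
    from eventually_prodI[OF always_eventually[of "\<lambda>_ :: nat. True"] this, of sequentially]
    show "eventually (\<lambda>(n, q). norm (t n q) \<le> 4 * (1 / 2) ^ n) (sequentially \<times>\<^sub>F at 0)"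
      by (rule eventually_mono) (use bound in auto)
  qed auto
  moreover have "(\<Sum>n. t n 0) = 1"
    by (subst suminf_finite[of "{0}"]) (auto simp: t_def qpoch_def)
  ultimately show ?thesis
    by (simp add: mock_omega_def [abs_def] t_def)
qed

section \<open>Separating the residue classes modulo 3 by cube roots of unity\<close>

text \<open>Fourier inversion on the group of order 3. Adding the equations isolates
  \<open>3 * X\<close>, since \<open>1 + w + w ^ 2 = 0\<close>; then \<open>Y\<close> carries the
  factor \<open>w - w ^ 2\<close>, which is nonzero.\<close>

lemma primitive_cube_root_system:
  fixes X Y Z w :: complex
  assumes w: "w ^ 2 + w + 1 = 0" and "X + Y + Z = 0" "X + w * Y + w ^ 2 * Z = 0" "X + w ^ 2 * Y + w * Z = 0"
  shows "X = 0" "Y = 0" "Z = 0"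
proof -
  have w3: "w ^ 3 = 1"
  proof -
    have "w ^ 3 - 1 = (w - 1) * (w ^ 2 + w + 1)" by (simp add: algebra_simps power2_eq_square power3_eq_cube)
    then show ?thesis using w by simp
  qed
  have "3 * X + (w ^ 2 + w + 1) * (Y + Z) = (X + Y + Z) + (X + w * Y + w ^ 2 * Z) + (X + w ^ 2 * Y + w * Z)"
    by (simp add: algebra_simps)
  then show X: "X = 0" using assms by simp
  have "(w - w ^ 2) * Y = (X + w * Y + w ^ 2 * Z) - w ^ 2 * (X + Y + Z) - (1 - w ^ 2) * X"
    by (simp add: algebra_simps)
  then have "(w - w ^ 2) * Y = 0"
    using assms(2,3) X by simp
  moreover have "w - w ^ 2 \<noteq> 0"
  proof
    assume *: "w - w ^ 2 = 0"
    then have "w ^ 2 = w"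
      by simp
    then have "w ^ 3 = w"
      by (metis power2_eq_square power3_eq_cube)
    with w w3 show False by simp
  qed
  ultimately show "Y = 0" by simp
  with X assms(2) show "Z = 0" by simp
qed

lemma complex_cube_root:
  fixes q :: complex
  obtains x where "q = x ^ 3"
proof (cases "q = 0")
  case True
  then show ?thesis using that[of 0] by simp
next
  case False
  then have "q = exp (Ln q / 3) ^ 3"
    by (simp flip: exp_of_nat_mult)
  then show ?thesis by (rule that)
qed

text \<open>At a cube root \<open>x\<close> of \<open>q\<close> the Taylor series of xi converges
  absolutely, because it converges at a real \<open>y\<close> between \<open>norm x\<close> and 1.
  The exponents \<open>3 * n + r\<close> form a subseries, from which \<open>x ^ r\<close> is
  divided out.\<close>

lemma summable_p_xi_progression:
  assumes "norm q < 1"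
  shows "summable (\<lambda>n. p_xi (3 * n + r) * q ^ n)"
proof (cases "q = 0")
  case True
  then show ?thesis
    using summable_finite[of "{0}" "\<lambda>n. p_xi (3 * n + r) * q ^ n"] by auto
next
  case False
  obtain x where x: "q = x ^ 3"
    by (rule complex_cube_root)
  have "norm x < 1"
    using assms unfolding x norm_power by (simp add: power_less_one_iff)
  moreover obtain y :: real where "norm x < y" "y < 1"
    using dense[OF \<open>norm x < 1\<close>] by blast
  ultimately have "summable (\<lambda>n. norm (p_xi n * x ^ n))"
    using p_xi_sums[of "of_real y"] norm_ge_zero[of x]
    by (intro powser_insidea[of _ "of_real y"]) (auto simp: sums_iff)
  then have "summable ((\<lambda>n. norm (p_xi n * x ^ n)) \<circ> (\<lambda>n. 3 * n + r))"
    by (rule summable_reindex) (auto simp: inj_on_def)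
  then have "summable (\<lambda>n. p_xi (3 * n + r) * x ^ (3 * n + r))"
    unfolding o_def by (rule summable_norm_cancel)
  moreover have "(\<lambda>n. p_xi (3 * n + r) * x ^ (3 * n + r)) = (\<lambda>n. x ^ r * (p_xi (3 * n + r) * q ^ n))"
    unfolding x power_add power_mult by (simp only: mult_ac)
  ultimately show ?thesis
    using False x by (simp add: summable_cmult_iff)
qed

definition p_xi_series :: "nat \<Rightarrow> complex \<Rightarrow> complex" where
  "p_xi_series r q = (\<Sum>n. p_xi (3 * n + r) * q ^ n)"

lemma p_xi_series_sums:
  assumes "norm q < 1"
  shows "(\<lambda>n. p_xi (3 * n + r) * q ^ n) sums p_xi_series r q"
  unfolding p_xi_series_def by (intro summable_sums summable_p_xi_progression assms)

lemma mock_xi_p_xi_series: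
  assumes x: "norm x < 1" and q: "q = x ^ 3"
  shows "mock_xi x = p_xi_series 0 q + x * p_xi_series 1 q + x ^ 2 * p_xi_series 2 q"
proof -
  have e: "x ^ (3 * n) = q ^ n" for n
    by (simp add: q power_mult)
  have "norm q < 1"
    unfolding q using x by (rule norm_power_less_one) simp
  then have "(\<lambda>n. p_xi (3 * n + 0) * q ^ n + x * (p_xi (3 * n + 1) * q ^ n) + x ^ 2 * (p_xi (3 * n + 2) * q ^ n))
      sums (p_xi_series 0 q + x * p_xi_series 1 q + x ^ 2 * p_xi_series 2 q)"
    by (intro sums_add sums_mult p_xi_series_sums)
  moreover have "(\<lambda>n. p_xi (3 * n + 0) * q ^ n + x * (p_xi (3 * n + 1) * q ^ n) + x ^ 2 * (p_xi (3 * n + 2) * q ^ n))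
      sums mock_xi x"
    using sums_group_3[OF p_xi_sums[OF x]] unfolding power_add e
    by (simp only: power_one_right add_0_right mult_ac)
  ultimately show ?thesis
    by (rule sums_unique2[symmetric])
qed

text \<open>Two dissections of \<open>mock_xi\<close> are compared: that of its power series and
  \<open>mock_xi_dissection\<close>. They agree at all three cube roots of \<open>q\<close>, so the
  coefficients of 1, \<open>x\<close> and \<open>x ^ 2\<close> agree.\<close>

lemma p_xi_series_eq:
  assumes q: "norm q < 1" "q \<noteq> 0"
  shows "p_xi_series 0 q = euler_f 2 q * euler_f 3 q ^ 4 / (euler_f 1 q ^ 2 * euler_f 6 q ^ 2)" (is "_ = ?A")
    and "p_xi_series 1 q = 2 * (euler_f 3 q * euler_f 6 q / euler_f 1 q)" (is "_ = ?B")
    and "p_xi_series 2 q = mock_omega q + euler_f 6 q ^ 4 / (euler_f 2 q * euler_f 3 q ^ 2)" (is "_ = ?C")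
proof -
  obtain x where x: "q = x ^ 3"
    by (rule complex_cube_root)
  then have nx: "norm x < 1" "x \<noteq> 0"
    using q unfolding x norm_power by (auto simp: power_less_one_iff)
  define w where "w = Complex (- 1 / 2) (sqrt 3 / 2)"
  have w: "w ^ 2 + w + 1 = 0"
    by (simp add: w_def complex_eq_iff power2_eq_square)
  then have w3: "w ^ 3 = 1"
    by algebra
  \<comment> \<open>Replacing \<open>x\<close> by \<open>z * x\<close> with \<open>z\<close> a cube
    root of unity leaves \<open>q\<close> fixed and only twists the three components.\<close>
  have key: "(p_xi_series 0 q - ?A) + z * (x * (p_xi_series 1 q - ?B)) + z ^ 2 * (x ^ 2 * (p_xi_series 2 q - ?C)) = 0"
    if "z ^ 3 = 1" "norm z = 1" for z
  proof -
    have zx: "norm (z * x) < 1" "z * x \<noteq> 0" "q = (z * x) ^ 3"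
      using nx that x by (auto simp: norm_mult power_mult_distrib)
    from mock_xi_dissection[OF zx] mock_xi_p_xi_series[OF zx(1,3)] show ?thesis
      by (simp add: algebra_simps power_mult_distrib)
  qed
  have nw: "norm w = 1"
    by (simp add: w_def cmod_def power_divide)
  have w4: "(w ^ 2) ^ 2 = w"
    using w3 by algebra
  note k = key[of 1] key[OF w3 nw] key[of "w ^ 2"]
  have "(w ^ 2) ^ 3 = 1" using w3 by (metis power_one power_commutes power_mult mult.commute)
  then have "p_xi_series 0 q - ?A = 0" "x * (p_xi_series 1 q - ?B) = 0" "x ^ 2 * (p_xi_series 2 q - ?C) = 0"
    using primitive_cube_root_system[OF w, of "p_xi_series 0 q - ?A" "x * (p_xi_series 1 q - ?B)" "x ^ 2 * (p_xi_series 2 q - ?C)"]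
      k nw unfolding w4 by (simp_all add: norm_power)
  then show "p_xi_series 0 q = ?A" "p_xi_series 1 q = ?B" "p_xi_series 2 q = ?C"
    using nx by simp_all
qed

lemma p_xi_series_tendsto_0: "(p_xi_series r \<longlongrightarrow> p_xi_series r 0) (at 0)"
proof -
  have "isCont (p_xi_series r) 0"
    unfolding p_xi_series_def [abs_def]
    by (rule isCont_powser[of _ "1 / 2"]) (auto intro!: summable_p_xi_progression)
  then show ?thesis by (simp add: isCont_def)
qed

text \<open>Continuity of the power series carries an identity on the punctured disc over to the
  origin.\<close>

lemma p_xi_series_0_eq:
  assumes "\<And>q. norm q < 1 \<Longrightarrow> q \<noteq> 0 \<Longrightarrow> p_xi_series r q = F q" "(F \<longlongrightarrow> L) (at 0)"
  shows "p_xi_series r 0 = L"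
proof (rule tendsto_unique[OF _ p_xi_series_tendsto_0])
  have "eventually (\<lambda>q :: complex. norm q < 1 \<and> q \<noteq> 0) (at 0)"
    by (auto simp: eventually_at intro!: exI[of _ 1])
  then show "(p_xi_series r \<longlongrightarrow> L) (at 0)"
    by (intro Lim_transform_eventually[OF assms(2)]) (erule eventually_mono, simp add: assms(1))
qed simp

theorem theorem3p2:
  fixes q :: complex
  assumes "norm q < 1"
  shows "((\<lambda>n. p_xi (3 * n) * q ^ n) sums
            (euler_f 2 q * euler_f 3 q ^ 4 / (euler_f 1 q ^ 2 * euler_f 6 q ^ 2))) \<and>
         ((\<lambda>n. p_xi (3 * n + 1) * q ^ n) sums
            (2 * (euler_f 3 q * euler_f 6 q / euler_f 1 q))) \<and>
         ((\<lambda>n. p_xi (3 * n + 2) * q ^ n) sums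
            (mock_omega q + euler_f 6 q ^ 4 / (euler_f 2 q * euler_f 3 q ^ 2)))"
proof -
  have "p_xi_series 0 q = euler_f 2 q * euler_f 3 q ^ 4 / (euler_f 1 q ^ 2 * euler_f 6 q ^ 2) \<and>
    p_xi_series 1 q = 2 * (euler_f 3 q * euler_f 6 q / euler_f 1 q) \<and>
    p_xi_series 2 q = mock_omega q + euler_f 6 q ^ 4 / (euler_f 2 q * euler_f 3 q ^ 2)"
  \<comment> \<open>At the origin a vanishing cube root cannot separate the components. There the
    series are evaluated as limits, and the right-hand sides directly, with every
    \<open>euler_f\<close> and \<open>mock_omega\<close> equal to 1.\<close>
  proof (cases "q = 0")
    case True
    have e0: "euler_f k 0 = 1" if "0 < k" for k
      using that by (simp add: euler_f_def qpoch_inf_def qpoch_def power_0_left tendsto_const[THEN limI])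
    have o0: "mock_omega 0 = 1"
    proof -
      have "mock_omega 0 = (\<Sum>n. if n = 0 then 1 else 0 :: complex)"
        unfolding mock_omega_def by (intro suminf_cong) (auto simp: qpoch_def)
      also have "\<dots> = 1" by (subst suminf_finite[of "{0}"]) auto
      finally show ?thesis .
    qed
    have "p_xi_series 0 0 = 1 * 1 ^ 4 / (1 ^ 2 * 1 ^ 2)"
      by (rule p_xi_series_0_eq[OF p_xi_series_eq(1)], assumption, assumption,
        intro tendsto_intros euler_f_tendsto_0 mock_omega_tendsto_0, simp_all)
    moreover have "p_xi_series 1 0 = 2 * (1 * 1 / 1)"
      by (rule p_xi_series_0_eq[OF p_xi_series_eq(2)], assumption, assumption,
        intro tendsto_intros euler_f_tendsto_0 mock_omega_tendsto_0, simp_all)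
    moreover have "p_xi_series 2 0 = 1 + 1 ^ 4 / (1 * 1 ^ 2)"
      by (rule p_xi_series_0_eq[OF p_xi_series_eq(3)], assumption, assumption,
        intro tendsto_intros euler_f_tendsto_0 mock_omega_tendsto_0, simp_all)
    ultimately show ?thesis
      unfolding True by (simp add: e0 o0)
  next
    case False
    then show ?thesis
      using p_xi_series_eq[OF assms] by simp
  qed
  then show ?thesis
    using p_xi_series_sums[OF assms, of 0] p_xi_series_sums[OF assms, of 1] p_xi_series_sums[OF assms, of 2]
    by simp
qed

end
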